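(* There is a computable principal ideal domain whose set of irreducible elements is $\Pi^0_2$-complete.
   Context: A computable ring is a computable set $R\subseteq\mathbb{N}$ with distinguished elements $0_R,1_R$ and computable binary operations $+,\cdot$ making it a commutative ring with unity. A principal ideal domain is an integral domain in which every ideal is principal. An element $r$ is irreducible if $r\neq0$, $r$ is not a unit, and whenever $r=ab$ one of $a,b$ is a unit. A set $X\subseteq\mathbb{N}$ is $\Pi^0_2$-complete if it is $\Pi^0_2$-definable and every $\Pi^0_2$ set $B$ is many-one reducible to it (there is a total computable $g$ with $n\in B\iff g(n)\in X$). *)

theory Defs
  imports "HOL-Algebra.Ring_Divisibility"
begin

section \<open>Partial recursive functions\<close>

datatype recf =
    Zero
  | Succ
  | Proj nat
  | Comp recf "recf list"
  | PrimRec recf recf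
  | Mu recf

text \<open>
  \<open>ev c xs y\<close>: the partial recursive function with code \<open>c\<close> is defined on the argument list
  \<open>xs\<close> and has value \<open>y\<close>. Codes carry no arity: the length of the argument list of every
  subcode is determined by the length of \<open>xs\<close>, and a code applied to a list of
  unsuitable length is undefined. Recursion and minimisation use the first argument.
\<close>

inductive ev :: "recf \<Rightarrow> nat list \<Rightarrow> nat \<Rightarrow> bool" where
  Zero: "ev Zero xs 0"
| Succ: "ev Succ [x] (Suc x)"
| Proj: "i < length xs \<Longrightarrow> ev (Proj i) xs (xs ! i)"
| Comp: "list_all2 (\<lambda>g y. ev g xs y) gs ys \<Longrightarrow> ev f ys z \<Longrightarrow> ev (Comp f gs) xs z"
| PrimRec_0: "ev f xs y \<Longrightarrow> ev (PrimRec f g) (0 # xs) y"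
| PrimRec_Suc: "ev (PrimRec f g) (n # xs) r \<Longrightarrow> ev g (n # r # xs) y
    \<Longrightarrow> ev (PrimRec f g) (Suc n # xs) y"
| Mu: "ev f (m # xs) 0 \<Longrightarrow> (\<forall>i<m. \<exists>v. ev f (i # xs) v \<and> v \<noteq> 0) \<Longrightarrow> ev (Mu f) xs m"

lemma ev_functional: "ev c xs y \<Longrightarrow> ev c xs z \<Longrightarrow> y = z"
proof (induction arbitrary: z rule: ev.induct)
  case (Zero xs)
  then show ?case by (cases rule: ev.cases) auto
next
  case (Succ x)
  then show ?case by (cases rule: ev.cases) auto
next
  case (Proj i xs)
  from Proj.prems show ?case by (cases rule: ev.cases) auto
next
  case (Comp xs gs ys f w)
  from Comp.prems obtain ys' where ys': "list_all2 (\<lambda>g y. ev g xs y) gs ys'" "ev f ys' z"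
    by (cases rule: ev.cases) auto
  have "ys = ys'"
    using Comp.IH(1) ys'(1) by (auto simp: list_all2_conv_all_nth intro!: nth_equalityI)
  with Comp.IH(2) ys'(2) show ?case by blast
next
  case (PrimRec_0 f xs y g)
  from PrimRec_0.prems have "ev f xs z" by (cases rule: ev.cases) auto
  with PrimRec_0.IH show ?case by blast
next
  case (PrimRec_Suc f g n xs r y)
  from PrimRec_Suc.prems obtain r' where "ev (PrimRec f g) (n # xs) r'" "ev g (n # r' # xs) z"
    by (cases rule: ev.cases) auto
  with PrimRec_Suc.IH show ?case by blast
next
  case (Mu f m xs)
  from Mu.prems have z: "ev f (z # xs) 0" "\<forall>i<z. \<exists>v. ev f (i # xs) v \<and> v \<noteq> 0"
    by (cases rule: ev.cases; auto)+
  show ?case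
  proof (rule linorder_cases[of m z])
    assume "m < z"
    with z(2) Mu.IH(1) show ?thesis by fastforce
  next
    assume "z < m"
    with z(1) Mu.IH(2) show ?thesis by fastforce
  qed
qed

section \<open>Computable functions, sets and relations\<close>

definition computable_fun :: "(nat \<Rightarrow> nat) \<Rightarrow> bool" where
  "computable_fun f \<longleftrightarrow> (\<exists>c. \<forall>x. ev c [x] (f x))"

definition computable_set :: "nat set \<Rightarrow> bool" where
  "computable_set X \<longleftrightarrow> (\<exists>c. \<forall>x. ev c [x] (of_bool (x \<in> X)))"

definition computable_rel3 :: "(nat \<Rightarrow> nat \<Rightarrow> nat \<Rightarrow> bool) \<Rightarrow> bool" where
  "computable_rel3 P \<longleftrightarrow> (\<exists>c. \<forall>x y z. ev c [x, y, z] (of_bool (P x y z)))"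

text \<open>
  The operations of a HOL-Algebra ring are unconstrained outside the carrier, so a binary
  operation on a set \<open>X\<close> is only required to agree with a partial recursive function on
  \<open>X \<times> X\<close>. If \<open>X\<close> is computable this amounts to the operation being the restriction of a
  total computable function.
\<close>

definition computable_op_on :: "nat set \<Rightarrow> (nat \<Rightarrow> nat \<Rightarrow> nat) \<Rightarrow> bool" where
  "computable_op_on X h \<longleftrightarrow> (\<exists>c. \<forall>x\<in>X. \<forall>y\<in>X. ev c [x, y] (h x y))"

section \<open>\<open>\<Pi>\<^sup>0\<^sub>2\<close>-completeness\<close>

definition Pi02 :: "nat set \<Rightarrow> bool" where
  "Pi02 X \<longleftrightarrow> (\<exists>P. computable_rel3 P \<and> X = {n. \<forall>x. \<exists>y. P n x y})"

definition many_one_reducible :: "nat set \<Rightarrow> nat set \<Rightarrow> bool" where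
  "many_one_reducible B X \<longleftrightarrow> (\<exists>g. computable_fun g \<and> (\<forall>n. n \<in> B \<longleftrightarrow> g n \<in> X))"

definition Pi02_complete :: "nat set \<Rightarrow> bool" where
  "Pi02_complete X \<longleftrightarrow> Pi02 X \<and> (\<forall>B. Pi02 B \<longrightarrow> many_one_reducible B X)"

section \<open>Computable rings\<close>

definition computable_ring :: "nat ring \<Rightarrow> bool" where
  "computable_ring R \<longleftrightarrow> cring R \<and> computable_set (carrier R)
     \<and> computable_op_on (carrier R) (\<lambda>x y. x \<oplus>\<^bsub>R\<^esub> y)
     \<and> computable_op_on (carrier R) (\<lambda>x y. x \<otimes>\<^bsub>R\<^esub> y)"

text \<open>
  \<^const>\<open>ring_irreducible\<close> is defined through proper factors; in an integral domain it is the
  usual notion.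
\<close>

lemma (in domain) ring_irreducible_iff:
  assumes "r \<in> carrier R"
  shows "ring_irreducible r \<longleftrightarrow> r \<noteq> \<zero> \<and> r \<notin> Units R \<and>
    (\<forall>a\<in>carrier R. \<forall>b\<in>carrier R. r = a \<otimes> b \<longrightarrow> a \<in> Units R \<or> b \<in> Units R)"
  using ring_irreducibleE[OF assms] ring_irreducibleI[of r] assms by blast

end

theory Submission
  imports Defs "HOL-Library.Nat_Bijection" "HOL-Library.Poly_Mapping" "HOL-Library.Z2"
    "HOL-Computational_Algebra.Primes" "HOL-Computational_Algebra.Fraction_Field"
begin

text \<open>
  The ring lives in the fraction field of the polynomial ring over the two-element field in
  variables \<open>r\<^sub>n\<close>, \<open>x\<^sub>n\<^sub>,\<^sub>s\<close> with \<open>s > 0\<close>, and a spare variable \<open>u\<close>. Let \<open>event n s\<close> be a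
  decidable relation, with \<open>event n 1\<close> always true, such that \<open>n\<close> has infinitely many events iff
  \<open>n\<close> belongs to a universal \<open>\<Pi>\<^sup>0\<^sub>2\<close> set. The elements of the ring are the fractions that are
  nonnegative at every \<open>r\<^sub>n\<close>-adic valuation and, whenever \<open>s\<close> is the last event of \<open>n\<close>, at the
  monomial valuation giving weight 1 to \<open>r\<^sub>n\<close> and \<open>x\<^sub>n\<^sub>,\<^sub>s\<close> and weight 0 to the other variables.
  If \<open>n\<close> has a last event \<open>s\<close>, then \<open>r\<^sub>n = x\<^sub>n\<^sub>,\<^sub>s (r\<^sub>n / x\<^sub>n\<^sub>,\<^sub>s)\<close> is a proper factorisation;
  otherwise \<open>r\<^sub>n\<close> has value 1 at its own valuation and 0 at all others, so it is irreducible. A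
  violated condition for an event that is not the last one is excused by exhibiting a later
  event, so membership is recursively enumerable.

  The ring is a principal ideal domain because for large \<open>m\<close> the monomials of \<open>a\<close> and \<open>u\<^sup>m b\<close>
  are disjoint, so \<open>a + u\<^sup>m b\<close> attains the minimum of the values of \<open>a\<close> and \<open>b\<close> at all
  valuations simultaneously. Hence an element of an ideal whose sum of values is least generates
  the ideal.
\<close>

text \<open>"Every factorisation has an invertible factor" has the quantifier shape forall-exists,
  so completeness depends on invertibility being merely enumerable. The events arrange this. As long
  as s is the latest event of n, the variable x_{n,s} is a non-unit factor of r_n. At the next event
  the condition for s is dropped, x_{n,s} becomes a unit, and this factorisation is spoiled. Making
  1 an event of every n ensures that finitely many events always include a last one. Enumerable
  membership is turned into a computable carrier by storing the excusing bound in the code of a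
  fraction and representing each element by its least code. Equality of coded fractions is decidable
  by cross multiplication, which takes place in the field and does not depend on the events. The
  variables are the primes and the monomials the positive integers, so polynomials multiply by
  Dirichlet convolution. Over the two-element field a polynomial is a finite set of positive
  integers, hence a number written in binary.\<close>

section \<open>Closure properties of recursive functions\<close>

text \<open>
  The list \<open>l e\<close> contains the values of the variables in the environment \<open>e\<close>. A binder adds a
  component to the environment, so that in \<open>\<lambda>p. fst p # l (snd p)\<close> the bound variable is \<open>fst p\<close>.
\<close>

definition recursive :: "('e \<Rightarrow> nat list) \<Rightarrow> ('e \<Rightarrow> nat) \<Rightarrow> bool" where
  "recursive l f \<longleftrightarrow> (\<exists>n. \<forall>e. length (l e) = n) \<and> (\<exists>c. \<forall>e. ev c (l e) (f e))"

definition is_variable :: "('e \<Rightarrow> nat list) \<Rightarrow> ('e \<Rightarrow> nat) \<Rightarrow> bool" where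
  "is_variable l f \<longleftrightarrow> (\<exists>n. \<forall>e. length (l e) = n) \<and> (\<exists>j. \<forall>e. j < length (l e) \<and> l e ! j = f e)"

abbreviation decidable :: "('e \<Rightarrow> nat list) \<Rightarrow> ('e \<Rightarrow> bool) \<Rightarrow> bool" where
  "decidable l P \<equiv> recursive l (\<lambda>e. of_bool (P e))"

definition fixed_length :: "('e \<Rightarrow> nat list) \<Rightarrow> bool" where
  "fixed_length l \<longleftrightarrow> (\<exists>n. \<forall>e. length (l e) = n)"

lemma fixed_length_Nil: "fixed_length (\<lambda>e. [])"
  by (simp add: fixed_length_def)

lemma fixed_length_Cons: "fixed_length l \<Longrightarrow> fixed_length (\<lambda>e. f e # l e)"
proof -
  assume "fixed_length l"
  then obtain n where "\<forall>e. length (l e) = n" unfolding fixed_length_def by blast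
  then have "\<forall>e. length (f e # l e) = Suc n" by simp
  then show ?thesis unfolding fixed_length_def by blast
qed

lemma is_variable_hd: "fixed_length l \<Longrightarrow> is_variable (\<lambda>e. f e # l e) f"
proof -
  assume "fixed_length l"
  then have "fixed_length (\<lambda>e. f e # l e)" by (rule fixed_length_Cons)
  moreover have "\<forall>e. 0 < length (f e # l e) \<and> (f e # l e) ! 0 = f e" by simp
  ultimately show ?thesis unfolding is_variable_def fixed_length_def by blast
qed

lemma is_variable_tl: "is_variable l f \<Longrightarrow> is_variable (\<lambda>e. g e # l e) f"
  unfolding is_variable_def by (auto, rule_tac x="Suc j" in exI, auto)

lemma recursive_is_variable: "is_variable l f \<Longrightarrow> recursive l f"
proof -
  assume "is_variable l f"
  then obtain n j where *: "\<forall>e. length (l e) = n" "\<forall>e. j < length (l e) \<and> l e ! j = f e"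
    unfolding is_variable_def by blast
  have "ev (Proj j) (l e) (f e)" for e using ev.Proj[of j "l e"] *(2) by simp
  with *(1) show ?thesis unfolding recursive_def by blast
qed

text \<open>\<open>recursive_is_variable\<close> would match every goal. Requiring the term to begin
  with \<open>fst\<close>, as all bound variables do, lets \<open>intro\<close> select the rule by
  the shape of the term. The primed version catches the eta-contracted variable at the head of the
  environment.\<close>

lemma recursive_fst: "is_variable l (\<lambda>e. fst (g e)) \<Longrightarrow> recursive l (\<lambda>e. fst (g e))"
  and recursive_fst': "is_variable l fst \<Longrightarrow> recursive l fst"
  by (fact recursive_is_variable)+

lemma recursive_const: "fixed_length l \<Longrightarrow> recursive l (\<lambda>e. k)"
proof (induction k)
  case 0 then show ?case unfolding recursive_def fixed_length_def using ev.Zero by blast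
next
  case (Suc k)
  then obtain c where c: "ev c (l e) k" for e unfolding recursive_def by auto
  have "ev (Comp recf.Succ [c]) (l e) (Suc k)" for e
    by (rule ev.Comp[where ys="[k]"]) (auto intro: c ev.Succ)
  with Suc.prems show ?case unfolding recursive_def fixed_length_def by blast
qed

lemma recursive_fixed_length: "recursive l a \<Longrightarrow> fixed_length l"
  unfolding recursive_def fixed_length_def by blast

text \<open>Substitution: recursiveness of F has to be proved only in the bare environment of its
  own arguments. The final \<open>unit\<close> component gives every argument, the last one
  included, the form \<open>fst ...\<close>.\<close>

lemma recursive_comp1:
  assumes "recursive (\<lambda>p::nat\<times>unit. [fst p]) (\<lambda>p. F (fst p))" "recursive l a"
  shows "recursive l (\<lambda>e. F (a e))"
proof -
  obtain c where c: "ev c [x] (F x)" for x using assms(1) unfolding recursive_def by auto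
  obtain ca where ca: "ev ca (l e) (a e)" for e using assms(2) unfolding recursive_def by auto
  have "ev (Comp c [ca]) (l e) (F (a e))" for e
    by (rule ev.Comp[where ys="[a e]"]) (auto intro: c ca)
  with assms(2) show ?thesis unfolding recursive_def by blast
qed

lemma recursive_comp2:
  assumes "recursive (\<lambda>p::nat\<times>nat\<times>unit. [fst p, fst (snd p)]) (\<lambda>p. F (fst p) (fst (snd p)))"
    "recursive l a" "recursive l b"
  shows "recursive l (\<lambda>e. F (a e) (b e))"
proof -
  obtain c where c: "ev c [x,y] (F x y)" for x y using assms(1) unfolding recursive_def by auto
  obtain ca where ca: "ev ca (l e) (a e)" for e using assms(2) unfolding recursive_def by auto
  obtain cb where cb: "ev cb (l e) (b e)" for e using assms(3) unfolding recursive_def by auto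
  have "ev (Comp c [ca,cb]) (l e) (F (a e) (b e))" for e
    by (rule ev.Comp[where ys="[a e, b e]"]) (auto intro: c ca cb)
  with assms(2) show ?thesis unfolding recursive_def by blast
qed

lemma recursive_comp3:
  assumes "recursive (\<lambda>p::nat\<times>nat\<times>nat\<times>unit. [fst p, fst (snd p), fst (snd (snd p))])
     (\<lambda>p. F (fst p) (fst (snd p)) (fst (snd (snd p))))"
    "recursive l a" "recursive l b" "recursive l d"
  shows "recursive l (\<lambda>e. F (a e) (b e) (d e))"
proof -
  obtain c where c: "ev c [x,y,z] (F x y z)" for x y z using assms(1) unfolding recursive_def
      by auto
  obtain ca where ca: "ev ca (l e) (a e)" for e using assms(2) unfolding recursive_def by auto
  obtain cb where cb: "ev cb (l e) (b e)" for e using assms(3) unfolding recursive_def by auto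
  obtain cd where cd: "ev cd (l e) (d e)" for e using assms(4) unfolding recursive_def by auto
  have "ev (Comp c [ca,cb,cd]) (l e) (F (a e) (b e) (d e))" for e
    by (rule ev.Comp[where ys="[a e, b e, d e]"]) (auto intro: c ca cb cd)
  with assms(2) show ?thesis unfolding recursive_def by blast
qed

lemma recursive_comp4:
  assumes "recursive (\<lambda>p::nat\<times>nat\<times>nat\<times>nat\<times>unit. [fst p, fst (snd p), fst (snd (snd p)), fst
      (snd (snd (snd p)))])
     (\<lambda>p. F (fst p) (fst (snd p)) (fst (snd (snd p))) (fst (snd (snd (snd p)))))"
    "recursive l a" "recursive l b" "recursive l d" "recursive l g"
  shows "recursive l (\<lambda>e. F (a e) (b e) (d e) (g e))"
proof -
  obtain c where c: "ev c [x,y,z,w] (F x y z w)" for x y z w using assms(1) unfolding recursive_def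
      by auto
  obtain ca where ca: "ev ca (l e) (a e)" for e using assms(2) unfolding recursive_def by auto
  obtain cb where cb: "ev cb (l e) (b e)" for e using assms(3) unfolding recursive_def by auto
  obtain cd where cd: "ev cd (l e) (d e)" for e using assms(4) unfolding recursive_def by auto
  obtain cg where cg: "ev cg (l e) (g e)" for e using assms(5) unfolding recursive_def by auto
  have "ev (Comp c [ca,cb,cd,cg]) (l e) (F (a e) (b e) (d e) (g e))" for e
    by (rule ev.Comp[where ys="[a e, b e, d e, g e]"]) (auto intro: c ca cb cd cg)
  with assms(2) show ?thesis unfolding recursive_def by blast
qed

lemma recursive_rec_nat:
  assumes "recursive l b" "recursive l a"
    "recursive (\<lambda>p. fst p # fst (snd p) # l (snd (snd p))) (\<lambda>p. h (fst p) (fst (snd p))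
        (snd (snd p)))"
  shows "recursive l (\<lambda>e. rec_nat (a e) (\<lambda>i r. h i r e) (b e))"
proof -
  obtain n where n: "length (l e) = n" for e using assms(1) unfolding recursive_def by blast
  obtain ca where ca: "ev ca (l e) (a e)" for e using assms(2) unfolding recursive_def by auto
  obtain cb where cb: "ev cb (l e) (b e)" for e using assms(1) unfolding recursive_def by auto
  obtain ch where ch: "ev ch (i # r # l e) (h i r e)" for i r e
    using assms(3) unfolding recursive_def by auto
  have pair: "ev (PrimRec ca ch) (m # l e) (rec_nat (a e) (\<lambda>i r. h i r e) m)" for m e
    by (induction m) (auto intro: ev.PrimRec_0 ev.PrimRec_Suc ca ch)
  \<comment> \<open>\<open>PrimRec\<close> passes on everything but the counter unchanged, so the
    code of the bound is put in front of all the projections.\<close>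
  have "ev (Comp (PrimRec ca ch) (cb # map Proj [0..<n])) (l e) (rec_nat (a e) (\<lambda>i r. h i r e)
      (b e))" for e
    by (rule ev.Comp[where ys="b e # l e"])
      (auto simp: list_all2_conv_all_nth n nth_Cons split: nat.split intro: cb pair ev.Proj)
  with assms(1) show ?thesis unfolding recursive_def by blast
qed

section \<open>Arithmetic, comparisons and propositional connectives\<close>

lemma recursive_Suc: "recursive l a \<Longrightarrow> recursive l (\<lambda>e. Suc (a e))"
proof (rule recursive_comp1[where F=Suc])
  show "recursive (\<lambda>p::nat\<times>unit. [fst p]) (\<lambda>p. Suc (fst p))"
    unfolding recursive_def using ev.Succ by fastforce
qed

lemmas recursive_basic_intros = recursive_Suc recursive_fst recursive_fst' is_variable_hd
    is_variable_tl fixed_length_Nil fixed_length_Cons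

lemma recursive_add: "recursive l a \<Longrightarrow> recursive l b \<Longrightarrow> recursive l (\<lambda>e. a e + b e)"
proof (rule recursive_comp2[where F="(+)"])
  have "rec_nat x (\<lambda>i. Suc) y = x + y" for x y by (induction y) auto
  moreover have "recursive (\<lambda>p::nat\<times>nat\<times>unit. [fst p, fst (snd p)])
      (\<lambda>p. rec_nat (fst p) (\<lambda>i r. Suc r) (fst (snd p)))"
    by (intro recursive_rec_nat recursive_basic_intros)
  ultimately show "recursive (\<lambda>p::nat\<times>nat\<times>unit. [fst p, fst (snd p)]) (\<lambda>p. fst p + fst (snd p))"
    by simp
qed

lemma recursive_diff: "recursive l a \<Longrightarrow> recursive l b \<Longrightarrow> recursive l (\<lambda>e. a e - b e)"
proof (rule recursive_comp2[where F="(-)"])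
  have 1: "rec_nat 0 (\<lambda>i r. i) y = y - 1" for y by (induction y) auto
  have pred: "recursive l (\<lambda>e. a e - 1)" if "recursive l a" for l :: "'e \<Rightarrow> _" and a
  proof (rule recursive_comp1[where F="\<lambda>x. x - 1", OF _ that])
    show "recursive (\<lambda>p::nat\<times>unit. [fst p]) (\<lambda>p. fst p - 1)"
      unfolding 1[symmetric] by (intro recursive_rec_nat recursive_const recursive_basic_intros)
  qed
  have "rec_nat x (\<lambda>i r. r - 1) y = x - y" for x y by (induction y) auto
  moreover have "recursive (\<lambda>p::nat\<times>nat\<times>unit. [fst p, fst (snd p)])
      (\<lambda>p. rec_nat (fst p) (\<lambda>i r. r - 1) (fst (snd p)))"
    by (intro recursive_rec_nat recursive_basic_intros pred)
  ultimately show "recursive (\<lambda>p::nat\<times>nat\<times>unit. [fst p, fst (snd p)]) (\<lambda>p. fst p - fst (snd p))"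
    by simp
qed

lemma recursive_mult: "recursive l a \<Longrightarrow> recursive l b \<Longrightarrow> recursive l (\<lambda>e. a e * b e)"
proof (rule recursive_comp2[where F="(*)"])
  have "rec_nat 0 (\<lambda>i r. x + r) y = x * y" for x y :: nat by (induction y) auto
  moreover have "recursive (\<lambda>p::nat\<times>nat\<times>unit. [fst p, fst (snd p)])
      (\<lambda>p. rec_nat 0 (\<lambda>i r. fst p + r) (fst (snd p)))"
    by (intro recursive_rec_nat recursive_basic_intros recursive_const recursive_add)
  ultimately show "recursive (\<lambda>p::nat\<times>nat\<times>unit. [fst p, fst (snd p)]) (\<lambda>p. fst p * fst (snd p))"
    by simp
qed

lemma recursive_power: "recursive l a \<Longrightarrow> recursive l b \<Longrightarrow> recursive l (\<lambda>e. a e ^ b e)"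
proof (rule recursive_comp2[where F="(^)"])
  have "rec_nat 1 (\<lambda>i r. x * r) y = x ^ y" for x y :: nat by (induction y) auto
  moreover have "recursive (\<lambda>p::nat\<times>nat\<times>unit. [fst p, fst (snd p)])
      (\<lambda>p. rec_nat 1 (\<lambda>i r. fst p * r) (fst (snd p)))"
    by (intro recursive_rec_nat recursive_basic_intros recursive_const recursive_mult)
  ultimately show "recursive (\<lambda>p::nat\<times>nat\<times>unit. [fst p, fst (snd p)]) (\<lambda>p. fst p ^ fst (snd p))"
    by simp
qed

lemma recursive_le: "recursive l a \<Longrightarrow> recursive l b \<Longrightarrow> decidable l (\<lambda>e. a e \<le> b e)"
proof -
  assume *: "recursive l a" "recursive l b"
  have "of_bool (x \<le> y) = 1 - (x - y)" for x y :: nat by auto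
  then show ?thesis using * by (simp only:) (intro recursive_diff recursive_const
      recursive_fixed_length)
qed

lemma recursive_less: "recursive l a \<Longrightarrow> recursive l b \<Longrightarrow> decidable l (\<lambda>e. a e < b e)"
  unfolding less_eq_Suc_le by (intro recursive_le recursive_Suc)

lemma recursive_conj: "decidable l P \<Longrightarrow> decidable l Q \<Longrightarrow> decidable l (\<lambda>e. P e \<and> Q e)"
  unfolding of_bool_conj by (intro recursive_mult)

lemma recursive_not: "decidable l P \<Longrightarrow> decidable l (\<lambda>e. \<not> P e)"
proof -
  assume *: "decidable l P"
  have "of_bool (\<not> p) = 1 - (of_bool p :: nat)" for p by auto
  then show ?thesis using * by (simp only:) (intro recursive_diff recursive_const
      recursive_fixed_length)
qed

lemma recursive_disj: "decidable l P \<Longrightarrow> decidable l Q \<Longrightarrow> decidable l (\<lambda>e. P e \<or> Q e)"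
  using recursive_not[OF recursive_conj[OF recursive_not recursive_not, of l P Q]] by simp

lemma recursive_imp: "decidable l P \<Longrightarrow> decidable l Q \<Longrightarrow> decidable l (\<lambda>e. P e \<longrightarrow> Q e)"
  unfolding imp_conv_disj by (intro recursive_disj recursive_not)

lemma recursive_eq: "recursive l a \<Longrightarrow> recursive l b \<Longrightarrow> decidable l (\<lambda>e. a e = b e)"
  unfolding order_eq_iff[where 'a=nat] by (intro recursive_conj recursive_le)

lemma recursive_iff: "decidable l P \<Longrightarrow> decidable l Q \<Longrightarrow> decidable l (\<lambda>e. P e \<longleftrightarrow> Q e)"
  unfolding iff_conv_conj_imp by (intro recursive_conj recursive_imp)

lemma recursive_if: "decidable l P \<Longrightarrow> recursive l a \<Longrightarrow> recursive l b \<Longrightarrow>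
    recursive l (\<lambda>e. if P e then a e else b e)"
proof -
  assume *: "decidable l P" "recursive l a" "recursive l b"
  have "(if p then x else y) = of_bool p * x + of_bool (\<not> p) * (y::nat)" for p x y by auto
  then show ?thesis using * by (simp only:) (intro recursive_add recursive_mult recursive_not)
qed

text \<open>Weakening: the step function of \<open>recursive_rec_nat\<close> also sees the
  accumulator, whereas the summand in \<open>recursive_sum\<close> depends on the index and the
  environment alone.\<close>

lemma recursive_swap:
  assumes "recursive (\<lambda>p. fst p # l (snd p)) (\<lambda>p. h (fst p) (snd p))"
  shows "recursive (\<lambda>p. fst p # fst (snd p) # l (snd (snd p))) (\<lambda>p. h (fst p) (snd (snd p)))"
proof -
  obtain m where m: "length (i # l e) = m" for i e using assms unfolding recursive_def by auto
  define n where "n = m - 1"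
  have n: "length (l e) = n" for e using m[of 0 e] by (simp add: n_def)
  obtain c where c: "ev c (i # l e) (h i e)" for e i using assms unfolding recursive_def by auto
  have P: "ev (Proj (Suc (Suc k))) (i # j # l e) (l e ! k)" if "k < n" for k i j e
    using ev.Proj[of "Suc (Suc k)" "i # j # l e"] that n by auto
  have P0: "ev (Proj 0) (i # xs) i" for i xs
    using ev.Proj[of 0 "i # xs"] by auto
  have "ev (Comp c (Proj 0 # map Proj [2..<Suc (Suc n)])) (i # j # l e) (h i e)" for i j e
    by (rule ev.Comp[where ys="i # l e"])
      (auto simp: list_all2_conv_all_nth n nth_Cons simp del: upt_Suc split: nat.split intro:
          c P P0)
  then show ?thesis unfolding recursive_def using n by auto
qed

section \<open>Bounded sums, bounded quantifiers and minimisation\<close>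

lemma recursive_sum:
  assumes "recursive l b" "recursive (\<lambda>p. fst p # l (snd p)) (\<lambda>p. h (fst p) (snd p))"
  shows "recursive l (\<lambda>e. \<Sum>i<b e. h i e)"
proof -
  have eq: "(\<Sum>i<m. f i) = rec_nat 0 (\<lambda>i r. r + f i) m" for f :: "nat \<Rightarrow> nat" and m
    by (induction m) auto
  show ?thesis unfolding eq
    using recursive_fixed_length[OF assms(1)]
    by (intro recursive_rec_nat assms recursive_const recursive_add recursive_swap recursive_fst
        is_variable_hd is_variable_tl fixed_length_Cons)
      (auto simp: fixed_length_def)
qed

lemma recursive_bex:
  assumes "recursive l b" "decidable (\<lambda>p. fst p # l (snd p)) (\<lambda>p. P (fst p) (snd p))"
  shows "decidable l (\<lambda>e. \<exists>i<b e. P i e)"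
proof -
  have "(\<exists>i<m. Q i) \<longleftrightarrow> 0 < (\<Sum>i<m. of_bool (Q i) :: nat)" for Q and m :: nat
    by (subst neq0_conv[symmetric], subst sum_eq_0_iff) auto
  then show ?thesis using assms recursive_fixed_length[OF assms(1)]
    by (simp only:) (intro recursive_less recursive_sum recursive_const)
qed

lemma recursive_ball:
  assumes "recursive l b" "decidable (\<lambda>p. fst p # l (snd p)) (\<lambda>p. P (fst p) (snd p))"
  shows "decidable l (\<lambda>e. \<forall>i<b e. P i e)"
  using recursive_not[OF recursive_bex[OF assms(1) recursive_not[OF assms(2)]]] by simp

lemma recursive_bex_le:
  assumes "recursive l b" "decidable (\<lambda>p. fst p # l (snd p)) (\<lambda>p. P (fst p) (snd p))"
  shows "decidable l (\<lambda>e. \<exists>i\<le>b e. P i e)"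
  using recursive_bex[OF recursive_Suc[OF assms(1)] assms(2)] by (simp add: less_Suc_eq_le)

lemma recursive_ball_le:
  assumes "recursive l b" "decidable (\<lambda>p. fst p # l (snd p)) (\<lambda>p. P (fst p) (snd p))"
  shows "decidable l (\<lambda>e. \<forall>i\<le>b e. P i e)"
  using recursive_ball[OF recursive_Suc[OF assms(1)] assms(2)] by (simp add: less_Suc_eq_le)

lemma recursive_Least:
  assumes "fixed_length l" "decidable (\<lambda>p. fst p # l (snd p)) (\<lambda>p. P (fst p) (snd p))"
      "\<And>e. \<exists>i. P i e"
  shows "recursive l (\<lambda>e. LEAST i. P i e)"
proof -
  \<comment> \<open>\<open>Mu\<close> looks for a zero, hence the negated predicate.\<close>
  have "recursive (\<lambda>p. fst p # l (snd p)) (\<lambda>p. of_bool (\<not> P (fst p) (snd p)))"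
    by (intro recursive_not assms)
  then obtain c where c: "ev c (i # l e) (of_bool (\<not> P i e))" for i e
    unfolding recursive_def by auto
  have "ev (Mu c) (l e) (LEAST i. P i e)" for e
  proof (rule ev.Mu)
    have "P (LEAST i. P i e) e" using assms(3) by (rule LeastI_ex)
    then show "ev c ((LEAST i. P i e) # l e) 0" using c[of "LEAST i. P i e" e] by simp
    show "\<forall>i<LEAST i. P i e. \<exists>v. ev c (i # l e) v \<and> v \<noteq> 0"
    proof (intro allI impI)
      fix i assume "i < (LEAST i. P i e)"
      then have "\<not> P i e" by (rule not_less_Least)
      with c[of i e] show "\<exists>v. ev c (i # l e) v \<and> v \<noteq> 0" by auto
    qed
  qed
  then show ?thesis using assms(1) unfolding recursive_def fixed_length_def by blast
qed

section \<open>Translation into the notions of the statement\<close>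

lemma computable_fun_iff: "computable_fun f \<longleftrightarrow> recursive (\<lambda>p::nat\<times>unit. [fst p]) (\<lambda>p. f (fst p))"
  unfolding recursive_def computable_fun_def by auto

lemma computable_set_iff: "computable_set X \<longleftrightarrow> decidable (\<lambda>p::nat\<times>unit. [fst p]) (\<lambda>p. fst p \<in> X)"
  unfolding recursive_def computable_set_def by auto

lemma computable_rel3_iff: "computable_rel3 P \<longleftrightarrow> decidable (\<lambda>p::nat\<times>nat\<times>nat\<times>unit. [fst p, fst
    (snd p), fst (snd (snd p))])
   (\<lambda>p. P (fst p) (fst (snd p)) (fst (snd (snd p))))"
  unfolding recursive_def computable_rel3_def by auto

lemma computable_op_onI: "recursive (\<lambda>p::nat\<times>nat\<times>unit. [fst p, fst (snd p)]) (\<lambda>p. f (fst p)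
    (fst (snd p)))
  \<Longrightarrow> computable_op_on X f"
  unfolding recursive_def computable_op_on_def by fastforce

lemmas recursive_intros = recursive_Suc recursive_fst recursive_fst' is_variable_hd is_variable_tl
    fixed_length_Nil fixed_length_Cons
  recursive_add recursive_diff recursive_mult recursive_power recursive_conj recursive_disj
      recursive_imp recursive_not recursive_if
  recursive_le recursive_less recursive_eq recursive_bex recursive_ball recursive_bex_le
      recursive_ball_le recursive_sum recursive_Least recursive_const

section \<open>Division, divisibility and finite sets coded by binary digits\<close>

lemma recursive_div: "recursive l a \<Longrightarrow> recursive l b \<Longrightarrow> recursive l (\<lambda>e. a e div b e)"
proof (rule recursive_comp2[where F="(div)"])
  \<comment> \<open>The sum counts the positive multiples of y up to x; the conjunct
    \<open>0 < y\<close> makes the quotient 0 for y = 0.\<close>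
  have "(\<Sum>i<x. of_bool (0 < y \<and> Suc i * y \<le> x)) = x div y" for x y :: nat
  proof (cases "y = 0")
    case False
    have "i < x \<and> 0 < y \<and> Suc i * y \<le> x \<longleftrightarrow> i < x div y" for i
    proof -
      have "Suc i * y \<le> x \<longleftrightarrow> i < x div y"
        using False by (simp add: less_eq_div_iff_mult_less_eq[symmetric] Suc_le_eq del: mult_Suc)
      moreover have "x div y \<le> x" by simp
      ultimately show ?thesis using False by (meson order_less_le_trans neq0_conv)
    qed
    then have "{..<x} \<inter> {i. 0 < y \<and> Suc i * y \<le> x} = {..<x div y}"
      by (auto simp del: mult_Suc)
    then show ?thesis by (simp add: of_bool_def sum.If_cases del: mult_Suc)
  qed simp
  moreover have "recursive (\<lambda>p::nat\<times>nat\<times>unit. [fst p, fst (snd p)])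
      (\<lambda>p. \<Sum>i<fst p. of_bool (0 < fst (snd p) \<and> Suc i * fst (snd p) \<le> fst p))"
    by (intro recursive_intros)
  ultimately show "recursive (\<lambda>p::nat\<times>nat\<times>unit. [fst p, fst (snd p)]) (\<lambda>p. fst p div fst (snd p))"
    by simp
qed

lemma recursive_mod: "recursive l a \<Longrightarrow> recursive l b \<Longrightarrow> recursive l (\<lambda>e. a e mod b e)"
  unfolding minus_mult_div_eq_mod[symmetric] by (intro recursive_diff recursive_mult recursive_div)

lemma recursive_dvd: "recursive l a \<Longrightarrow> recursive l b \<Longrightarrow> decidable l (\<lambda>e. a e dvd b e)"
  unfolding dvd_eq_mod_eq_0 by (intro recursive_eq recursive_mod recursive_const
      recursive_fixed_length)

lemma recursive_mem: "recursive l a \<Longrightarrow> recursive l b \<Longrightarrow> decidable l (\<lambda>e. a e \<in> set_decode (b e))"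
  unfolding set_decode_def mem_Collect_eq
  by (intro recursive_not recursive_dvd recursive_div recursive_power recursive_const
      recursive_fixed_length)

lemma recursive_set_encode:
  assumes "recursive l b" "decidable (\<lambda>p. fst p # l (snd p)) (\<lambda>p. P (fst p) (snd p))"
  shows "recursive l (\<lambda>e. set_encode {i. i < b e \<and> P i e})"
proof -
  have "set_encode {i. i < m \<and> Q i} = (\<Sum>i<m. 2 ^ i * of_bool (Q i))" for m Q
  proof -
    have "(\<Sum>i<m. 2 ^ i * of_bool (Q i)) = (\<Sum>i\<in>{..<m}. if Q i then 2 ^ i else (0::nat))"
      by (intro sum.cong) auto
    also have "\<dots> = (\<Sum>i\<in>{..<m} \<inter> Collect Q. 2 ^ i)" by (simp add: sum.If_cases)
    also have "{..<m} \<inter> Collect Q = {i. i < m \<and> Q i}" by auto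
    finally show ?thesis by (simp add: set_encode_def)
  qed
  then show ?thesis using recursive_fixed_length[OF assms(1)] recursive_fixed_length[OF assms(2)]
    by (simp only:) (intro recursive_sum recursive_mult recursive_power recursive_fst recursive_fst'
        assms recursive_const is_variable_hd; assumption?; simp add: fixed_length_def)
qed

section \<open>Pairing, primes and multiplicities\<close>

definition pair :: "nat \<Rightarrow> nat \<Rightarrow> nat" where "pair x y = prod_encode (x, y)"
definition pair_fst :: "nat \<Rightarrow> nat" where "pair_fst z = fst (prod_decode z)"
definition pair_snd :: "nat \<Rightarrow> nat" where "pair_snd z = snd (prod_decode z)"

lemma pair_simps [simp]: "pair_fst (pair x y) = x" "pair_snd (pair x y) = y"
    "pair (pair_fst z) (pair_snd z) = z"
  "pair x y = pair x' y' \<longleftrightarrow> x = x' \<and> y = y'"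
  by (simp_all add: pair_def pair_fst_def pair_snd_def)

lemma pair_ge: "x \<le> pair x y" "y \<le> pair x y"
  by (simp_all add: pair_def le_prod_encode_1 le_prod_encode_2)

lemma pair_fst_le: "pair_fst z \<le> z" and pair_snd_le: "pair_snd z \<le> z"
  using pair_ge(1)[of "pair_fst z" "pair_snd z"] pair_ge(2)[of "pair_snd z" "pair_fst z"]
      by simp_all

lemma recursive_pair: "recursive l a \<Longrightarrow> recursive l b \<Longrightarrow> recursive l (\<lambda>e. pair (a e) (b e))"
  unfolding pair_def prod_encode_def prod.case triangle_def
  by (intro recursive_add recursive_div recursive_mult recursive_Suc recursive_const
      recursive_fixed_length)

lemma recursive_pair_fst: "recursive l a \<Longrightarrow> recursive l (\<lambda>e. pair_fst (a e))"
proof (rule recursive_comp1[where F=pair_fst])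
  \<comment> \<open>Both components are bounded by the pair, so a bounded search suffices; the sum
    merely picks out the unique index that passes the test.\<close>
  have "(\<Sum>i<Suc z. i * of_bool (\<exists>j\<le>z. pair i j = z)) = pair_fst z" for z
  proof -
    have "(\<exists>j\<le>z. pair i j = z) \<longleftrightarrow> i = pair_fst z" for i
      using pair_ge by (metis pair_simps(1,3))
    then have "(\<Sum>i<Suc z. i * of_bool (\<exists>j\<le>z. pair i j = z)) = (\<Sum>i<Suc z. if i = pair_fst z then i
        else 0)"
      by (intro sum.cong) auto
    then show ?thesis
      using pair_fst_le[of z] by simp
  qed
  moreover have "recursive (\<lambda>p::nat\<times>unit. [fst p])
      (\<lambda>p. \<Sum>i<Suc (fst p). i * of_bool (\<exists>j\<le>fst p. pair i j = fst p))"
    by (intro recursive_intros recursive_pair)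
  ultimately show "recursive (\<lambda>p::nat\<times>unit. [fst p]) (\<lambda>p. pair_fst (fst p))" by (simp only:)
qed

lemma recursive_pair_snd: "recursive l a \<Longrightarrow> recursive l (\<lambda>e. pair_snd (a e))"
proof (rule recursive_comp1[where F=pair_snd])
  have "(\<Sum>i<Suc z. i * of_bool (pair (pair_fst z) i = z)) = pair_snd z" for z
  proof -
    have "pair (pair_fst z) i = z \<longleftrightarrow> i = pair_snd z" for i
      by (metis pair_simps(2,3))
    then have "(\<Sum>i<Suc z. i * of_bool (pair (pair_fst z) i = z)) = (\<Sum>i<Suc z. if i = pair_snd z then
        i else 0)"
      by (intro sum.cong) auto
    then show ?thesis
      using pair_snd_le[of z] by simp
  qed
  moreover have "recursive (\<lambda>p::nat\<times>unit. [fst p])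
      (\<lambda>p. \<Sum>i<Suc (fst p). i * of_bool (pair (pair_fst (fst p)) i = fst p))"
    by (intro recursive_intros recursive_pair recursive_pair_fst)
  ultimately show "recursive (\<lambda>p::nat\<times>unit. [fst p]) (\<lambda>p. pair_snd (fst p))" by (simp only:)
qed

lemma recursive_prime: "recursive l a \<Longrightarrow> decidable l (\<lambda>e. prime (a e))"
proof (rule recursive_comp1[where F="\<lambda>x. of_bool (prime x)"])
  have "prime p \<longleftrightarrow> 1 < p \<and> (\<forall>n<p. n dvd p \<longrightarrow> n = 1)" for p :: nat
  proof -
    have "n = 1 \<or> n = p" if "1 < p" "\<forall>n<p. n dvd p \<longrightarrow> n = 1" "n dvd p" for n
    proof (cases "n < p")
      case False
      with dvd_imp_le[OF that(3)] that(1) show ?thesis by simp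
    qed (use that in blast)
    moreover have "n = 1" if "prime p" "n < p" "n dvd p" for n
      using that unfolding prime_nat_iff by blast
    ultimately show ?thesis unfolding prime_nat_iff by blast
  qed
  moreover have "recursive (\<lambda>p::nat\<times>unit. [fst p])
      (\<lambda>p. of_bool (1 < fst p \<and> (\<forall>n<fst p. n dvd fst p \<longrightarrow> n = 1)))"
    by (intro recursive_intros recursive_dvd)
  ultimately show "recursive (\<lambda>p::nat\<times>unit. [fst p]) (\<lambda>p. of_bool (prime (fst p)))" by (simp only:)
qed

text \<open>The prime 2 is left out: it plays the role of the spare variable \<open>u\<close>.\<close>

definition odd_prime :: "nat \<Rightarrow> nat" where
  "odd_prime k = rec_nat 3 (\<lambda>i r. LEAST q. r < q \<and> prime q) k"

lemma recursive_odd_prime: "recursive l a \<Longrightarrow> recursive l (\<lambda>e. odd_prime (a e))"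
proof (rule recursive_comp1[where F=odd_prime])
  show "recursive (\<lambda>p::nat\<times>unit. [fst p]) (\<lambda>p. odd_prime (fst p))"
    unfolding odd_prime_def
    by (intro recursive_rec_nat recursive_intros recursive_prime) (metis bigger_prime)
qed

lemma odd_prime_Suc: "odd_prime k < odd_prime (Suc k)" "prime (odd_prime (Suc k))"
proof -
  have "\<exists>q. odd_prime k < q \<and> prime q" by (metis bigger_prime)
  then have "odd_prime k < (LEAST q. odd_prime k < q \<and> prime q) \<and> prime (LEAST q. odd_prime k < q \<and>
      prime q)"
    by (rule LeastI_ex)
  moreover have "odd_prime (Suc k) = (LEAST q. odd_prime k < q \<and> prime q)"
      by (simp add: odd_prime_def)
  ultimately show "odd_prime k < odd_prime (Suc k)" "prime (odd_prime (Suc k))" by auto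
qed

lemma prime_odd_prime: "prime (odd_prime k)"
proof (cases k)
  case 0
  have "prime (3::nat)" by simp
  then show ?thesis using 0 by (simp add: odd_prime_def)
qed (simp add: odd_prime_Suc)

lemma strict_mono_odd_prime: "strict_mono odd_prime"
  by (simp add: strict_mono_Suc_iff odd_prime_Suc)

lemma odd_prime_eq [simp]: "odd_prime k = odd_prime j \<longleftrightarrow> k = j"
  using strict_mono_odd_prime by (metis strict_mono_eq)

text \<open>A prime divisor is at most the number it divides, so this bounds the indices of the
  variables in a monomial by the index of the monomial.\<close>

lemma odd_prime_gt: "k + 2 < odd_prime k"
proof (induction k)
  case (Suc k) then show ?case using odd_prime_Suc(1)[of k] by simp
qed (simp add: odd_prime_def)

lemma recursive_multiplicity: "recursive l a \<Longrightarrow> recursive l b \<Longrightarrow>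
    recursive l (\<lambda>e. multiplicity (odd_prime (a e)) (Suc (b e)))"
proof (rule recursive_comp2[where F="\<lambda>x y. multiplicity (odd_prime x) (Suc y)"])
  have "(\<Sum>i<Suc y. of_bool (odd_prime x ^ Suc i dvd Suc y)) = multiplicity (odd_prime x) (Suc y)"
      for x y
  proof -
    let ?m = "multiplicity (odd_prime x) (Suc y)"
    have nu: "\<not> is_unit (odd_prime x)" using prime_odd_prime by (metis not_prime_unit)
    \<comment> \<open>The chain m < 2 ^ m <= p ^ m <= y + 1 shows that counting exponents only up to
      y + 1 misses none.\<close>
    have "?m < 2 ^ ?m" by (rule less_exp)
    also have "\<dots> \<le> odd_prime x ^ ?m" by (simp add: power_mono prime_ge_2_nat[OF prime_odd_prime])
    also have "\<dots> \<le> Suc y" by (intro dvd_imp_le multiplicity_dvd) simp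
    finally have "{i \<in> {..<Suc y}. odd_prime x ^ Suc i dvd Suc y} = {..<?m}"
      using nu by (auto simp del: power_Suc simp: power_dvd_iff_le_multiplicity)
    then show ?thesis by (simp add: of_bool_def sum.If_cases Int_def del:
        power_Suc sum.lessThan_Suc)
  qed
  moreover have "recursive (\<lambda>p::nat\<times>nat\<times>unit. [fst p, fst (snd p)])
      (\<lambda>p. \<Sum>i<Suc (fst (snd p)). of_bool (odd_prime (fst p) ^ Suc i dvd Suc (fst (snd p))))"
    by (intro recursive_intros recursive_dvd recursive_odd_prime)
  ultimately show "recursive (\<lambda>p::nat\<times>nat\<times>unit. [fst p, fst (snd p)])
     (\<lambda>p. multiplicity (odd_prime (fst p)) (Suc (fst (snd p))))"
    by (simp only:)
qed

section \<open>A universal recursively enumerable relation\<close>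

definition fact_code :: "nat \<Rightarrow> nat \<Rightarrow> nat \<Rightarrow> nat \<Rightarrow> nat" where
  "fact_code k a b c = pair k (pair a (pair b c))"

definition cons_code :: "nat \<Rightarrow> nat \<Rightarrow> nat" where "cons_code x xs = Suc (pair x xs)"

lemma fact_code_eq [simp]: "fact_code k a b c = fact_code k' a' b' c' \<longleftrightarrow> k = k' \<and> a = a' \<and> b = b' \<and>
    c = c'"
  by (simp add: fact_code_def)

lemma cons_code_eq [simp]: "cons_code x xs = cons_code y ys \<longleftrightarrow> x = y \<and> xs = ys" "cons_code x xs \<noteq> 0"
    "0 \<noteq> cons_code x xs"
  by (simp_all add: cons_code_def)

lemma list_encode_cons_code: "list_encode (x # xs) = cons_code x (list_encode xs)"
  by (simp add: cons_code_def pair_def)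

lemma cons_code_list_encode: "cons_code x xs = list_encode zs \<longleftrightarrow> (\<exists>ys. zs = x # ys \<and>
    xs = list_encode ys)"
  by (cases zs) (auto simp: list_encode_cons_code simp del: list_encode.simps(2))

lemma zero_list_encode: "0 = list_encode zs \<longleftrightarrow> zs = []" "list_encode zs = 0 \<longleftrightarrow> zs = []"
  by (cases zs; simp)+

fun recf_code :: "recf \<Rightarrow> nat" where
  "recf_code Zero = pair 0 0"
| "recf_code recf.Succ = pair 6 0"
| "recf_code (Proj i) = pair 2 i"
| "recf_code (Comp f gs) = pair 3 (pair (recf_code f) (list_encode (map recf_code gs)))"
| "recf_code (PrimRec f g) = pair 4 (pair (recf_code f) (recf_code g))"
| "recf_code (Mu f) = pair 5 (recf_code f)"

text \<open>
  One-step derivability of a fact from the facts in \<open>E\<close>, with all parameters bounded by \<open>M\<close>. Facts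
  carry a tag: 0 for \<^const>\<open>ev\<close>, 4 for the simultaneous evaluation of an argument list,
  2 for \<open>f\<close> being nonzero at all \<open>i < m\<close>, and 3 for the \<open>i\<close>-th entry of a list being \<open>y\<close>.
\<close>

inductive justified :: "nat \<Rightarrow> nat set \<Rightarrow> nat \<Rightarrow> bool" for M E where
  Zero: "xs \<le> M \<Longrightarrow> justified M E (fact_code 0 (pair 0 0) xs 0)"
| Succ: "x \<le> M \<Longrightarrow> justified M E (fact_code 0 (pair 6 0) (cons_code x 0) (Suc x))"
| Proj: "i \<le> M \<Longrightarrow> xs \<le> M \<Longrightarrow> y \<le> M \<Longrightarrow>
      fact_code 3 i xs y \<in> E \<Longrightarrow> justified M E (fact_code 0 (pair 2 i) xs y)"
| Comp: "f \<le> M \<Longrightarrow> gs \<le> M \<Longrightarrow> xs \<le> M \<Longrightarrow> ys \<le> M \<Longrightarrow> z \<le> M \<Longrightarrow>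
      fact_code 4 gs xs ys \<in> E \<Longrightarrow>
      fact_code 0 f ys z \<in> E \<Longrightarrow> justified M E (fact_code 0 (pair 3 (pair f gs)) xs z)"
| PrimRec_0: "f \<le> M \<Longrightarrow> g \<le> M \<Longrightarrow> xs \<le> M \<Longrightarrow> y \<le> M \<Longrightarrow>
      fact_code 0 f xs y \<in> E \<Longrightarrow> justified M E (fact_code 0 (pair 4 (pair f g)) (cons_code 0 xs) y)"
| PrimRec_Suc: "f \<le> M \<Longrightarrow> g \<le> M \<Longrightarrow> n \<le> M \<Longrightarrow> xs \<le> M \<Longrightarrow> r \<le> M \<Longrightarrow> y \<le> M \<Longrightarrow>
      fact_code 0 (pair 4 (pair f g)) (cons_code n xs) r \<in> E \<Longrightarrow>
      fact_code 0 g (cons_code n (cons_code r xs)) y \<in> E \<Longrightarrow>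
      justified M E (fact_code 0 (pair 4 (pair f g)) (cons_code (Suc n) xs) y)"
| Mu: "f \<le> M \<Longrightarrow> xs \<le> M \<Longrightarrow> m \<le> M \<Longrightarrow>
      fact_code 0 f (cons_code m xs) 0 \<in> E \<Longrightarrow>
      fact_code 2 f m xs \<in> E \<Longrightarrow> justified M E (fact_code 0 (pair 5 f) xs m)"
| args_Nil: "xs \<le> M \<Longrightarrow> justified M E (fact_code 4 0 xs 0)"
| args_Cons: "g \<le> M \<Longrightarrow> gs \<le> M \<Longrightarrow> xs \<le> M \<Longrightarrow> y \<le> M \<Longrightarrow> ys \<le> M \<Longrightarrow>
      fact_code 0 g xs y \<in> E \<Longrightarrow>
      fact_code 4 gs xs ys \<in> E \<Longrightarrow> justified M E (fact_code 4 (cons_code g gs) xs (cons_code y ys))"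
| nz_0: "f \<le> M \<Longrightarrow> xs \<le> M \<Longrightarrow> justified M E (fact_code 2 f 0 xs)"
| nz_Suc: "f \<le> M \<Longrightarrow> m \<le> M \<Longrightarrow> xs \<le> M \<Longrightarrow> v \<le> M \<Longrightarrow>
      fact_code 0 f (cons_code m xs) (Suc v) \<in> E \<Longrightarrow>
      fact_code 2 f m xs \<in> E \<Longrightarrow> justified M E (fact_code 2 f (Suc m) xs)"
| nth_0: "x \<le> M \<Longrightarrow> xs \<le> M \<Longrightarrow> justified M E (fact_code 3 0 (cons_code x xs) x)"
| nth_Suc: "i \<le> M \<Longrightarrow> x \<le> M \<Longrightarrow> xs \<le> M \<Longrightarrow> y \<le> M \<Longrightarrow>
      fact_code 3 i xs y \<in> E \<Longrightarrow> justified M E (fact_code 3 (Suc i) (cons_code x xs) y)"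

text \<open>This form is the reason for the parameter bound in \<open>justified\<close>: with only
  bounded quantifiers, one derivation step is decidable by the closure rules.\<close>

lemma justified_iff:
  "justified M E F \<longleftrightarrow>
    (\<exists>xs\<le>M. F = fact_code 0 (pair 0 0) xs 0)
  \<or> (\<exists>x\<le>M. F = fact_code 0 (pair 6 0) (cons_code x 0) (Suc x))
  \<or> (\<exists>i\<le>M. \<exists>xs\<le>M. \<exists>y\<le>M. F = fact_code 0 (pair 2 i) xs y \<and> fact_code 3 i xs y \<in> E)
  \<or> (\<exists>f\<le>M. \<exists>gs\<le>M. \<exists>xs\<le>M. \<exists>ys\<le>M. \<exists>z\<le>M. F = fact_code 0 (pair 3 (pair f gs)) xs z \<and>
      fact_code 4 gs xs ys \<in> E \<and> fact_code 0 f ys z \<in> E)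
  \<or> (\<exists>f\<le>M. \<exists>g\<le>M. \<exists>xs\<le>M. \<exists>y\<le>M. F = fact_code 0 (pair 4 (pair f g)) (cons_code 0 xs) y \<and>
      fact_code 0 f xs y \<in> E)
  \<or> (\<exists>f\<le>M. \<exists>g\<le>M. \<exists>n\<le>M. \<exists>xs\<le>M. \<exists>r\<le>M. \<exists>y\<le>M. F = fact_code 0 (pair 4 (pair f g)) (cons_code (Suc n) xs)
      y \<and> fact_code 0 (pair 4 (pair f g)) (cons_code n xs) r \<in> E \<and> fact_code 0 g (cons_code n
          (cons_code r xs)) y \<in> E)
  \<or> (\<exists>f\<le>M. \<exists>xs\<le>M. \<exists>m\<le>M. F = fact_code 0 (pair 5 f) xs m \<and> fact_code 0 f (cons_code m xs) 0 \<in> E \<and>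
      fact_code 2 f m xs \<in> E)
  \<or> (\<exists>xs\<le>M. F = fact_code 4 0 xs 0)
  \<or> (\<exists>g\<le>M. \<exists>gs\<le>M. \<exists>xs\<le>M. \<exists>y\<le>M. \<exists>ys\<le>M. F = fact_code 4 (cons_code g gs) xs (cons_code y ys) \<and>
      fact_code 0 g xs y \<in> E \<and> fact_code 4 gs xs ys \<in> E)
  \<or> (\<exists>f\<le>M. \<exists>xs\<le>M. F = fact_code 2 f 0 xs)
  \<or> (\<exists>f\<le>M. \<exists>m\<le>M. \<exists>xs\<le>M. \<exists>v\<le>M. F = fact_code 2 f (Suc m) xs \<and> fact_code 0 f (cons_code m xs) (Suc v)
      \<in> E \<and> fact_code 2 f m xs \<in> E)
  \<or> (\<exists>x\<le>M. \<exists>xs\<le>M. F = fact_code 3 0 (cons_code x xs) x)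
  \<or> (\<exists>i\<le>M. \<exists>x\<le>M. \<exists>xs\<le>M. \<exists>y\<le>M. F = fact_code 3 (Suc i) (cons_code x xs) y \<and> fact_code 3 i xs y \<in> E)"
  unfolding justified.simps[of M E F]
  by (intro arg_cong2[where f="(\<or>)"]; blast)

text \<open>Derivations are replaced by a growing sequence of finite sets of facts, each stored in
  the binary digits of a number. At step k both facts and parameters are bounded by k, so the stages
  arise by primitive recursion, and yet every derivation fits into one of them.\<close>

definition stage :: "nat \<Rightarrow> nat" where
  "stage k = rec_nat 0 (\<lambda>k E. set_encode {F. F < Suc k \<and> justified k (set_decode E) F}) k"

lemma mem_stage_Suc: "F \<in> set_decode (stage (Suc k)) \<longleftrightarrow> F \<le> k \<and> justified k (set_decode (stage k)) F"
  by (simp add: stage_def set_encode_inverse less_Suc_eq_le)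

lemma stage_0: "set_decode (stage 0) = {}"
  by (simp add: stage_def)

lemma justified_mono: "justified M E F \<Longrightarrow> M \<le> M' \<Longrightarrow> E \<subseteq> E' \<Longrightarrow> justified M' E' F"
  by (induction rule: justified.induct) (rule justified.intros; auto)+

lemma stage_mono: "i \<le> j \<Longrightarrow> set_decode (stage i) \<subseteq> set_decode (stage j)"
proof (rule lift_Suc_mono_le[of "\<lambda>i. set_decode (stage i)"])
  fix n show "set_decode (stage n) \<subseteq> set_decode (stage (Suc n))"
  proof (induction n)
    case (Suc n)
    show ?case
    proof
      fix F assume "F \<in> set_decode (stage (Suc n))"
      then have "F \<le> n" "justified n (set_decode (stage n)) F" by (simp_all add: mem_stage_Suc)
      moreover have "justified (Suc n) (set_decode (stage (Suc n))) F"
        by (rule justified_mono[OF \<open>justified n (set_decode (stage n)) F\<close> _ Suc]) simp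
      ultimately show "F \<in> set_decode (stage (Suc (Suc n)))" by (simp add: mem_stage_Suc)
    qed
  qed (simp add: stage_0)
qed

definition derivable :: "nat \<Rightarrow> bool" where "derivable F \<longleftrightarrow> (\<exists>k. F \<in> set_decode (stage k))"

lemma eventually_derivable: "derivable F \<Longrightarrow> \<forall>\<^sub>F k in sequentially. F \<in> set_decode (stage k)"
  unfolding derivable_def eventually_sequentially using stage_mono by blast

text \<open>Stating premises and size bounds as \<open>eventually\<close> conditions brings all of
  them to a common stage without computing a maximum for each rule.\<close>

lemma derivableI: "\<forall>\<^sub>F k in sequentially. justified k (set_decode (stage k)) F \<Longrightarrow> derivable F"
proof -
  assume "\<forall>\<^sub>F k in sequentially. justified k (set_decode (stage k)) F"
  then have "\<forall>\<^sub>F k in sequentially. justified k (set_decode (stage k)) F \<and> F \<le> k"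
    using eventually_ge_at_top by (rule eventually_conj)
  then obtain k where "justified k (set_decode (stage k)) F" "F \<le> k"
    unfolding eventually_sequentially by blast
  then have "F \<in> set_decode (stage (Suc k))" by (simp add: mem_stage_Suc)
  then show ?thesis unfolding derivable_def ..
qed

section \<open>Closure of the derivable facts under the rules\<close>

lemma derivable_Zero:
  shows "derivable (fact_code 0 (pair 0 0) xs 0)"
  using eventually_ge_at_top[of xs]
  by (intro derivableI, eventually_elim) (rule justified.Zero)

lemma derivable_Succ:
  shows "derivable (fact_code 0 (pair 6 0) (cons_code x 0) (Suc x))"
  using eventually_ge_at_top[of x]
  by (intro derivableI, eventually_elim) (rule justified.Succ)

lemma derivable_Proj:
  assumes "derivable (fact_code 3 i xs y)"
  shows "derivable (fact_code 0 (pair 2 i) xs y)"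
  using assms[THEN eventually_derivable] eventually_ge_at_top[of i] eventually_ge_at_top[of xs]
      eventually_ge_at_top[of y]
  by (intro derivableI, eventually_elim) (rule justified.Proj)

lemma derivable_Comp:
  assumes "derivable (fact_code 4 gs xs ys)" "derivable (fact_code 0 f ys z)"
  shows "derivable (fact_code 0 (pair 3 (pair f gs)) xs z)"
  using assms[THEN eventually_derivable] eventually_ge_at_top[of f] eventually_ge_at_top[of gs]
      eventually_ge_at_top[of xs] eventually_ge_at_top[of ys] eventually_ge_at_top[of z]
  by (intro derivableI, eventually_elim) (rule justified.Comp)

lemma derivable_PrimRec_0:
  assumes "derivable (fact_code 0 f xs y)"
  shows "derivable (fact_code 0 (pair 4 (pair f g)) (cons_code 0 xs) y)"
  using assms[THEN eventually_derivable] eventually_ge_at_top[of f] eventually_ge_at_top[of g]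
      eventually_ge_at_top[of xs] eventually_ge_at_top[of y]
  by (intro derivableI, eventually_elim) (rule justified.PrimRec_0)

lemma derivable_PrimRec_Suc:
  assumes "derivable (fact_code 0 (pair 4 (pair f g)) (cons_code n xs) r)"
      "derivable (fact_code 0 g (cons_code n (cons_code r xs)) y)"
  shows "derivable (fact_code 0 (pair 4 (pair f g)) (cons_code (Suc n) xs) y)"
  using assms[THEN eventually_derivable] eventually_ge_at_top[of f] eventually_ge_at_top[of g]
      eventually_ge_at_top[of n] eventually_ge_at_top[of xs] eventually_ge_at_top[of r]
          eventually_ge_at_top[of y]
  by (intro derivableI, eventually_elim) (rule justified.PrimRec_Suc)

lemma derivable_Mu:
  assumes "derivable (fact_code 0 f (cons_code m xs) 0)" "derivable (fact_code 2 f m xs)"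
  shows "derivable (fact_code 0 (pair 5 f) xs m)"
  using assms[THEN eventually_derivable] eventually_ge_at_top[of f] eventually_ge_at_top[of xs]
      eventually_ge_at_top[of m]
  by (intro derivableI, eventually_elim) (rule justified.Mu)

lemma derivable_args_Nil:
  shows "derivable (fact_code 4 0 xs 0)"
  using eventually_ge_at_top[of xs]
  by (intro derivableI, eventually_elim) (rule justified.args_Nil)

lemma derivable_args_Cons:
  assumes "derivable (fact_code 0 g xs y)" "derivable (fact_code 4 gs xs ys)"
  shows "derivable (fact_code 4 (cons_code g gs) xs (cons_code y ys))"
  using assms[THEN eventually_derivable] eventually_ge_at_top[of g] eventually_ge_at_top[of gs]
      eventually_ge_at_top[of xs] eventually_ge_at_top[of y] eventually_ge_at_top[of ys]
  by (intro derivableI, eventually_elim) (rule justified.args_Cons)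

lemma derivable_nz_0:
  shows "derivable (fact_code 2 f 0 xs)"
  using eventually_ge_at_top[of f] eventually_ge_at_top[of xs]
  by (intro derivableI, eventually_elim) (rule justified.nz_0)

lemma derivable_nz_Suc:
  assumes "derivable (fact_code 0 f (cons_code m xs) (Suc v))" "derivable (fact_code 2 f m xs)"
  shows "derivable (fact_code 2 f (Suc m) xs)"
  using assms[THEN eventually_derivable] eventually_ge_at_top[of f] eventually_ge_at_top[of m]
      eventually_ge_at_top[of xs] eventually_ge_at_top[of v]
  by (intro derivableI, eventually_elim) (rule justified.nz_Suc)

lemma derivable_nth_0:
  shows "derivable (fact_code 3 0 (cons_code x xs) x)"
  using eventually_ge_at_top[of x] eventually_ge_at_top[of xs]
  by (intro derivableI, eventually_elim) (rule justified.nth_0)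

lemma derivable_nth_Suc:
  assumes "derivable (fact_code 3 i xs y)"
  shows "derivable (fact_code 3 (Suc i) (cons_code x xs) y)"
  using assms[THEN eventually_derivable] eventually_ge_at_top[of i] eventually_ge_at_top[of x]
      eventually_ge_at_top[of xs] eventually_ge_at_top[of y]
  by (intro derivableI, eventually_elim) (rule justified.nth_Suc)

section \<open>Completeness: evaluations are derivable\<close>

lemma derivable_nth: "i < length xs \<Longrightarrow> derivable (fact_code 3 i (list_encode xs) (xs ! i))"
proof (induction xs arbitrary: i)
  case (Cons x xs)
  then show ?case
    by (cases i) (auto simp: list_encode_cons_code simp del: list_encode.simps(2) intro:
        derivable_nth_0 derivable_nth_Suc)
qed simp

lemma derivable_args:
  "list_all2 (\<lambda>g y. derivable (fact_code 0 (recf_code g) xs y)) gs ys \<Longrightarrow>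
     derivable (fact_code 4 (list_encode (map recf_code gs)) xs (list_encode ys))"
  by (induction rule: list_all2_induct)
    (auto simp: list_encode_cons_code simp del: list_encode.simps(2) intro:
        derivable_args_Nil[simplified] derivable_args_Cons)

lemma derivable_nz:
  "\<forall>i<m. \<exists>v. derivable (fact_code 0 f (cons_code i xs) v) \<and> v \<noteq> 0 \<Longrightarrow> derivable (fact_code 2 f m xs)"
proof (induction m)
  case (Suc m)
  then obtain v where "derivable (fact_code 0 f (cons_code m xs) v)" "v \<noteq> 0" by blast
  with Suc show ?case by (cases v) (auto intro: derivable_nz_Suc)
qed (rule derivable_nz_0)

lemma ev_imp_derivable: "ev c xs y \<Longrightarrow> derivable (fact_code 0 (recf_code c) (list_encode xs) y)"
proof (induction rule: ev.induct)
  case (Zero xs)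
  then show ?case using derivable_Zero by simp
next
  case (Succ x)
  then show ?case using derivable_Succ[of x] by (simp add: list_encode_cons_code del:
      list_encode.simps(2))
next
  case (Proj i xs)
  then show ?case by (simp add: derivable_Proj derivable_nth)
next
  case (Comp xs gs ys f z)
  then have "derivable (fact_code 4 (list_encode (map recf_code gs)) (list_encode xs) (list_encode
      ys))"
    by (intro derivable_args) (auto elim: list_all2_mono)
  with Comp show ?case by (simp add: derivable_Comp)
next
  case (PrimRec_0 f xs y g)
  then show ?case by (simp add: list_encode_cons_code derivable_PrimRec_0 del: list_encode.simps(2))
next
  case (PrimRec_Suc f g n xs r y)
  then show ?case by (auto simp add: list_encode_cons_code simp del: list_encode.simps(2) intro:
      derivable_PrimRec_Suc)
next
  case (Mu f m xs)
  then have "derivable (fact_code 2 (recf_code f) m (list_encode xs))"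
    by (intro derivable_nz) (auto simp: list_encode_cons_code simp del: list_encode.simps(2))
  with Mu show ?case by (simp add: list_encode_cons_code derivable_Mu del: list_encode.simps(2))
qed

section \<open>Soundness: derivable facts are true\<close>

definition sound_fact :: "nat \<Rightarrow> bool" where
  "sound_fact F \<longleftrightarrow> (\<forall>c xs y. F = fact_code 0 (recf_code c) (list_encode xs) y \<longrightarrow> ev c xs y)
    \<and> (\<forall>gs xs ys. F = fact_code 4 (list_encode (map recf_code gs)) (list_encode xs) (list_encode ys)
        \<longrightarrow>
          list_all2 (\<lambda>g y. ev g xs y) gs ys)
    \<and> (\<forall>f m xs. F = fact_code 2 (recf_code f) m (list_encode xs) \<longrightarrow> (\<forall>i<m. \<exists>v. ev f (i # xs) v \<and>
        v \<noteq> 0))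
    \<and> (\<forall>i xs y. F = fact_code 3 i (list_encode xs) y \<longrightarrow> i < length xs \<and> xs ! i = y)"

lemmas soundD =
  sound_fact_def[THEN iffD1, THEN conjunct1, THEN spec, THEN spec, THEN spec, THEN mp, OF _ refl]
  sound_fact_def[THEN iffD1, THEN conjunct2, THEN conjunct1, THEN spec, THEN spec, THEN spec, THEN
      mp, OF _ refl]
  sound_fact_def[THEN iffD1, THEN conjunct2, THEN conjunct2, THEN conjunct1, THEN spec, THEN spec,
      THEN spec, THEN mp, OF _ refl]
  sound_fact_def[THEN iffD1, THEN conjunct2, THEN conjunct2, THEN conjunct2, THEN spec, THEN spec,
      THEN spec, THEN mp, OF _ refl]

lemma ex_list_encode: "\<exists>ys. n = list_encode ys"
  using list_decode_inverse[of n] by metis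

text \<open>\<open>sound_fact\<close> constrains only facts about codes of actual programs and is
  vacuous for other program numbers, so each rule is checked by inverting
  \<open>recf_code\<close>.\<close>

lemma justified_sound_fact:
  assumes E: "\<And>F. F \<in> E \<Longrightarrow> sound_fact F" and "justified M E F"
  shows "sound_fact F"
  using assms(2)
proof cases
  show "sound_fact F" if "F = fact_code 0 (pair 0 0) xs 0" for xs
  proof -
    have "ev c zs 0" if "pair 0 0 = recf_code c" for c zs using that by (cases c) (auto intro:
        ev.Zero)
    with that show ?thesis by (auto simp: sound_fact_def)
  qed
  show "sound_fact F" if "F = fact_code 0 (pair 6 0) (cons_code x 0) (Suc x)" for x
  proof -
    have "ev c [x] (Suc x)" if "pair 6 0 = recf_code c" for c using that by (cases c) (auto intro:
        ev.Succ)
    with that show ?thesis by (auto simp: sound_fact_def cons_code_list_encode zero_list_encode)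
  qed
  show "sound_fact F" if "F = fact_code 0 (pair 2 i) xs y" "fact_code 3 i xs y \<in> E" for i xs y
  proof -
    have "ev c zs y" if "pair 2 i = recf_code c" "xs = list_encode zs" for c zs
      using that E[OF \<open>fact_code 3 i xs y \<in> _\<close>] soundD(4)[of i zs y]
      by (cases c) (auto intro: ev.Proj)
    with that show ?thesis by (auto simp: sound_fact_def)
  qed
  show "sound_fact F" if "F = fact_code 0 (pair 3 (pair f gs)) xs z"
        and p: "fact_code 4 gs xs ys \<in> E" "fact_code 0 f ys z \<in> E" for f gs xs ys z
  proof -
    have "ev c zs z" if c: "pair 3 (pair f gs) = recf_code c" "xs = list_encode zs" for c zs
    proof -
      obtain f' gs' where c': "c = Comp f' gs'" "f = recf_code f'" "gs = list_encode (map recf_code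
          gs')"
        using c(1) by (cases c) auto
      \<comment> \<open>The intermediate argument list enters the rule as a bare number, but every
        number codes a list.\<close>
      obtain ys' where ys: "ys = list_encode ys'" using ex_list_encode by blast
      show ?thesis using soundD(1)[of f' ys' z] soundD(2)[of gs' zs ys'] p[THEN E] c(2)
        by (auto simp: c' ys intro: ev.Comp)
    qed
    with that show ?thesis by (auto simp: sound_fact_def)
  qed
  show "sound_fact F" if "F = fact_code 0 (pair 4 (pair f g)) (cons_code 0 xs) y" and p:
      "fact_code 0 f xs y \<in> E"
    for f g xs y
  proof -
    have "ev c (0 # zs) y" if "pair 4 (pair f g) = recf_code c" "xs = list_encode zs" for c zs
      using that soundD(1)[of _ zs y] p[THEN E] by (cases c) (auto intro: ev.PrimRec_0)
    with that show ?thesis by (auto simp: sound_fact_def cons_code_list_encode)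
  qed
  show "sound_fact F" if "F = fact_code 0 (pair 4 (pair f g)) (cons_code (Suc n) xs) y"
    and p: "fact_code 0 (pair 4 (pair f g)) (cons_code n xs) r \<in> E"
        "fact_code 0 g (cons_code n (cons_code r xs)) y \<in> E"
    for f g n xs r y
  proof -
    have "ev c (Suc n # zs) y" if c: "pair 4 (pair f g) = recf_code c" "xs = list_encode zs"
        for c zs
    proof -
      obtain f' g' where c': "c = PrimRec f' g'" "f = recf_code f'" "g = recf_code g'"
        using c(1) by (cases c) auto
      show ?thesis using soundD(1)[of c "n # zs" r] soundD(1)[of g' "n # r # zs" y] p[THEN E] c(2)
        by (auto simp: c' list_encode_cons_code simp del: list_encode.simps(2) intro:
            ev.PrimRec_Suc)
    qed
    with that show ?thesis by (auto simp: sound_fact_def cons_code_list_encode)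
  qed
  show "sound_fact F" if "F = fact_code 0 (pair 5 f) xs m"
    and p: "fact_code 0 f (cons_code m xs) 0 \<in> E" "fact_code 2 f m xs \<in> E" for f xs m
  proof -
    have "ev c zs m" if c: "pair 5 f = recf_code c" "xs = list_encode zs" for c zs
    proof -
      obtain f' where c': "c = Mu f'" "f = recf_code f'" using c(1) by (cases c) auto
      show ?thesis using soundD(1)[of f' "m # zs" 0] soundD(3)[of f' m zs] p[THEN E] c(2)
        by (auto simp: c' list_encode_cons_code simp del: list_encode.simps(2) intro: ev.Mu)
    qed
    with that show ?thesis by (auto simp: sound_fact_def)
  qed
  show "sound_fact F" if "F = fact_code 4 0 xs 0" for xs
    using that by (auto simp: sound_fact_def zero_list_encode)
  show "sound_fact F" if "F = fact_code 4 (cons_code g gs) xs (cons_code y ys)"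
    and p: "fact_code 0 g xs y \<in> E" "fact_code 4 gs xs ys \<in> E" for g gs xs y ys
  proof -
    have "list_all2 (\<lambda>g y. ev g zs y) gs' ys'"
      if enc: "cons_code g gs = list_encode (map recf_code gs')" "xs = list_encode zs"
          "cons_code y ys = list_encode ys'"
      for gs' zs ys'
    proof -
      obtain g1 gs1 where gs': "gs' = g1 # gs1" "g = recf_code g1" "gs = list_encode (map recf_code
          gs1)"
        using enc(1) by (auto simp: cons_code_list_encode map_eq_Cons_conv simp del:
            list_encode.simps)
      obtain ys1 where ys': "ys' = y # ys1" "ys = list_encode ys1"
        using enc(3) by (auto simp: cons_code_list_encode)
      show ?thesis using soundD(1)[of g1 zs y] soundD(2)[of gs1 zs ys1] p[THEN E] enc(2)
        by (auto simp: gs' ys')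
    qed
    with that show ?thesis by (auto simp: sound_fact_def)
  qed
  show "sound_fact F" if "F = fact_code 2 f 0 xs" for f xs
    using that by (auto simp: sound_fact_def)
  show "sound_fact F" if "F = fact_code 2 f (Suc m) xs" and p:
      "fact_code 0 f (cons_code m xs) (Suc v) \<in> E"
    "fact_code 2 f m xs \<in> E" for f m xs v
  proof -
    have "\<exists>v. ev f' (i # zs) v \<and> v \<noteq> 0" if "f = recf_code f'" "xs = list_encode zs" "i < Suc m"
        for f' zs i
      using soundD(1)[of f' "m # zs" "Suc v"] soundD(3)[of f' m zs] p[THEN E] that
      by (auto simp: list_encode_cons_code less_Suc_eq simp del: list_encode.simps(2))
    with that show ?thesis by (auto simp: sound_fact_def)
  qed
  show "sound_fact F" if "F = fact_code 3 0 (cons_code x xs) x" for x xs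
    using that by (auto simp: sound_fact_def cons_code_list_encode)
  show "sound_fact F" if "F = fact_code 3 (Suc i) (cons_code x xs) y" and p:
      "fact_code 3 i xs y \<in> E" for i x xs y
  proof -
    have "Suc i < length zs \<and> zs ! Suc i = y" if enc: "cons_code x xs = list_encode zs" for zs
    proof -
      obtain zs' where "zs = x # zs'" "xs = list_encode zs'" using enc cons_code_list_encode
          by blast
      then show ?thesis using soundD(4)[of i zs' y] p[THEN E] by simp
    qed
    with that show ?thesis by (auto simp: sound_fact_def)
  qed
qed

lemma derivable_sound_fact: "derivable F \<Longrightarrow> sound_fact F"
proof -
  have "\<forall>F. F \<in> set_decode (stage k) \<longrightarrow> sound_fact F" for k
    by (induction k) (auto simp: stage_0 mem_stage_Suc intro: justified_sound_fact)
  then show "derivable F \<Longrightarrow> sound_fact F" unfolding derivable_def by blast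
qed

lemma derivable_iff_ev: "derivable (fact_code 0 (recf_code c) (list_encode xs) y) \<longleftrightarrow> ev c xs y"
  using ev_imp_derivable derivable_sound_fact soundD(1) by blast

section \<open>Decidability of the stages and the universal relation\<close>

lemma recursive_fact_code: "recursive l k \<Longrightarrow> recursive l a \<Longrightarrow> recursive l b \<Longrightarrow> recursive l c \<Longrightarrow>
    recursive l (\<lambda>e. fact_code (k e) (a e) (b e) (c e))"
  unfolding fact_code_def by (intro recursive_pair)

lemma recursive_cons_code: "recursive l a \<Longrightarrow> recursive l b \<Longrightarrow> recursive l (\<lambda>e. cons_code (a e) (b e))"
  unfolding cons_code_def by (intro recursive_pair recursive_Suc)

lemma recursive_justified: "recursive l a \<Longrightarrow> recursive l b \<Longrightarrow> recursive l c \<Longrightarrow>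
    decidable l (\<lambda>e. justified (a e) (set_decode (b e)) (c e))"
  by (rule recursive_comp3[where F="\<lambda>a b c. of_bool (justified a (set_decode b) c)"], unfold
      justified_iff,
      intro recursive_intros recursive_fact_code recursive_cons_code recursive_pair recursive_mem)

lemma recursive_stage: "recursive l a \<Longrightarrow> recursive l (\<lambda>e. stage (a e))"
  by (rule recursive_comp1[where F=stage], unfold stage_def,
      intro recursive_rec_nat recursive_set_encode recursive_justified recursive_intros)

text \<open>The number d packs an existential witness with a stage by which the value 1 has been
  derived. In this way an enumerable relation becomes a decidable one under a single quantifier over
  d.\<close>

definition universal :: "nat \<Rightarrow> nat \<Rightarrow> nat \<Rightarrow> nat \<Rightarrow> bool" where
  "universal c n x d \<longleftrightarrow> fact_code 0 c (cons_code n (cons_code x (cons_code (pair_fst d) 0))) 1 \<in>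
      set_decode (stage (pair_snd d))"

lemma recursive_universal: "recursive l a \<Longrightarrow> recursive l b \<Longrightarrow> recursive l c \<Longrightarrow> recursive l d \<Longrightarrow>
    decidable l (\<lambda>e. universal (a e) (b e) (c e) (d e))"
  unfolding universal_def
  by (intro recursive_mem recursive_stage recursive_fact_code recursive_cons_code recursive_pair_fst
      recursive_pair_snd recursive_const recursive_fixed_length)

lemma universal_complete:
  assumes "computable_rel3 P"
  shows "\<exists>c. \<forall>n x. (\<exists>y. P n x y) \<longleftrightarrow> (\<exists>d. universal c n x d)"
proof -
  obtain c where c: "ev c [n, x, y] (of_bool (P n x y))" for n x y
    using assms unfolding computable_rel3_def by blast
  have P: "P n x y \<longleftrightarrow> ev c [n, x, y] 1" for n x y
    using c[of n x y] ev_functional[OF c[of n x y], of 1] by (cases "P n x y") auto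
  have "(\<exists>d. universal (recf_code c) n x d) \<longleftrightarrow> (\<exists>y. derivable (fact_code 0 (recf_code c) (cons_code n
      (cons_code x (cons_code y 0))) 1))" for n x
    unfolding universal_def derivable_def by (metis pair_simps(1,2))
  moreover have "cons_code n (cons_code x (cons_code y 0)) = list_encode [n, x, y]" for n x y
    by (simp add: list_encode_cons_code del: list_encode.simps(2))
  ultimately have "(\<exists>d. universal (recf_code c) n x d) \<longleftrightarrow> (\<exists>y. P n x y)" for n x
    by (simp only: derivable_iff_ev P)
  then show ?thesis by metis
qed

section \<open>Principal ideal domains from families of valuations\<close>

text \<open>\<open>mixing\<close> takes the place of a Bezout identity: w is a unit of the ring of
  integers, so for integral x and y the element x + w y lies in the ideal they generate and has the
  values of a greatest common divisor. The values at 0 are arbitrary, whence the nonzero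
  hypotheses.\<close>

locale valued_field =
  fixes V :: "('k::field \<Rightarrow> int) set"
  assumes val_mult: "v \<in> V \<Longrightarrow> x \<noteq> 0 \<Longrightarrow> y \<noteq> 0 \<Longrightarrow> v (x * y) = v x + v y"
    and val_add: "v \<in> V \<Longrightarrow> x \<noteq> 0 \<Longrightarrow> y \<noteq> 0 \<Longrightarrow> x + y \<noteq> 0 \<Longrightarrow> min (v x) (v y) \<le> v (x + y)"
    and finite_support: "x \<noteq> 0 \<Longrightarrow> finite {v \<in> V. v x \<noteq> 0}"
    and mixing: "x \<noteq> 0 \<Longrightarrow> y \<noteq> 0 \<Longrightarrow>
      \<exists>w. w \<noteq> 0 \<and> x + w * y \<noteq> 0 \<and> (\<forall>v\<in>V. v w = 0 \<and> v (x + w * y) = min (v x) (v y))"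
begin

definition integers :: "'k set" where
  "integers = {x. x = 0 \<or> (\<forall>v\<in>V. 0 \<le> v x)}"

lemma val_1: "v \<in> V \<Longrightarrow> v 1 = 0"
  using val_mult[of v 1 1] by simp

lemma val_inverse: "v \<in> V \<Longrightarrow> x \<noteq> 0 \<Longrightarrow> v (inverse x) = - v x"
  using val_mult[of v x "inverse x"] val_1[of v] by simp

lemma val_minus: "v \<in> V \<Longrightarrow> x \<noteq> 0 \<Longrightarrow> v (- x) = v x"
proof -
  assume "v \<in> V" "x \<noteq> 0"
  then have "v (- 1) = 0"
    using val_mult[of v "- 1" "- 1"] val_1[of v] by simp
  with \<open>v \<in> V\<close> \<open>x \<noteq> 0\<close> show ?thesis using val_mult[of v "- 1" x] by simp
qed

lemma integers_closed:
  "0 \<in> integers" "1 \<in> integers"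
  "x \<in> integers \<Longrightarrow> y \<in> integers \<Longrightarrow> x + y \<in> integers"
  "x \<in> integers \<Longrightarrow> y \<in> integers \<Longrightarrow> x * y \<in> integers"
  "x \<in> integers \<Longrightarrow> - x \<in> integers"
proof -
  show "0 \<in> integers" "1 \<in> integers" by (simp_all add: integers_def val_1)
  show "x + y \<in> integers" if "x \<in> integers" "y \<in> integers"
  proof (cases "x = 0 \<or> y = 0 \<or> x + y = 0")
    case False
    then show ?thesis using that val_add[of _ x y] unfolding integers_def by fastforce
  qed (use that in \<open>auto simp: integers_def\<close>)
  show "x * y \<in> integers" if "x \<in> integers" "y \<in> integers"
    using that by (cases "x = 0 \<or> y = 0") (auto simp: integers_def val_mult)
  show "- x \<in> integers" if "x \<in> integers"
    using that by (auto simp: integers_def val_minus)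
qed

definition val_norm :: "'k \<Rightarrow> nat" where
  "val_norm x = nat (\<Sum>v\<in>{v \<in> V. v x \<noteq> 0}. v x)"

lemma val_norm_less:
  assumes "x \<noteq> 0" "y \<noteq> 0" "y \<in> integers" "\<And>v. v \<in> V \<Longrightarrow> v y \<le> v x" "v \<in> V" "v y < v x"
  shows "val_norm y < val_norm x"
proof -
  \<comment> \<open>Over the union of both supports the two sums can be compared term by
    term.\<close>
  let ?S = "{v \<in> V. v x \<noteq> 0} \<union> {v \<in> V. v y \<noteq> 0}"
  have fin: "finite ?S" using assms finite_support by blast
  have nn: "0 \<le> v y" if "v \<in> V" for v using assms(2,3) that by (auto simp: integers_def)
  have x: "(\<Sum>v\<in>{v \<in> V. v x \<noteq> 0}. v x) = (\<Sum>v\<in>?S. v x)"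
    and y: "(\<Sum>v\<in>{v \<in> V. v y \<noteq> 0}. v y) = (\<Sum>v\<in>?S. v y)"
    using fin by (auto intro!: sum.mono_neutral_left)
  have "v \<in> ?S" using assms(5,6) nn[OF assms(5)] by auto
  then have "(\<Sum>v\<in>?S. v y) < (\<Sum>v\<in>?S. v x)"
    using fin assms(4,6) by (intro sum_strict_mono_ex1) auto
  moreover have "0 \<le> (\<Sum>v\<in>?S. v y)" using nn by (intro sum_nonneg) auto
  ultimately show ?thesis unfolding val_norm_def x y by simp
qed

lemma integers_principal:
  assumes J: "J \<subseteq> integers" "0 \<in> J" "\<And>x y. x \<in> J \<Longrightarrow> y \<in> J \<Longrightarrow> x + y \<in> J"
    "\<And>x a. x \<in> J \<Longrightarrow> a \<in> integers \<Longrightarrow> a * x \<in> J"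
  shows "\<exists>c\<in>J. \<forall>x\<in>J. \<exists>a\<in>integers. x = a * c"
proof (cases "J = {0}")
  case True
  then show ?thesis by (auto intro: integers_closed)
next
  case False
  with J(2) obtain z where "z \<in> J" "z \<noteq> 0" by blast
  then obtain c where c: "c \<in> J" "c \<noteq> 0" and min: "\<And>y. y \<in> J \<Longrightarrow> y \<noteq> 0 \<Longrightarrow> val_norm c \<le> val_norm y"
    using ex_has_least_nat[of "\<lambda>c. c \<in> J \<and> c \<noteq> 0" z val_norm] by blast
  have "\<exists>a\<in>integers. x = a * c" if x: "x \<in> J" for x
  proof (cases "x = 0")
    case True
    then show ?thesis using integers_closed(1) by (intro bexI[of _ 0]) auto
  next
    case False
    then obtain w where w: "w \<noteq> 0" "c + w * x \<noteq> 0" "\<And>v. v \<in> V \<Longrightarrow> v w = 0"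
      "\<And>v. v \<in> V \<Longrightarrow> v (c + w * x) = min (v c) (v x)"
      using mixing[OF c(2) False] by blast
    have "w \<in> integers" using w(3) by (fastforce simp: integers_def)
    then have d: "c + w * x \<in> J" using J(3,4) x c(1) by blast
    have "v c \<le> v x" if "v \<in> V" for v
    proof (rule ccontr)
      \<comment> \<open>If x were below c at v, the mixed element would be below c at v and nowhere
        above it, against the choice of c. Hence x / c is integral.\<close>
      assume "\<not> v c \<le> v x"
      then have "val_norm (c + w * x) < val_norm c"
        using that c(2) w(2) d J(1) by (intro val_norm_less[of _ _ v]) (auto simp: w(4))
      with min[OF d w(2)] show False by simp
    qed
    then have "x * inverse c \<in> integers"
      using False c(2) by (auto simp: integers_def val_mult val_inverse)
    moreover have "x = (x * inverse c) * c" using c(2) by simp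
    ultimately show ?thesis by blast
  qed
  with c(1) show ?thesis by blast
qed

lemma integers_unit_iff:
  "x \<in> integers \<Longrightarrow> (\<exists>y\<in>integers. x * y = 1) \<longleftrightarrow> x \<noteq> 0 \<and> (\<forall>v\<in>V. v x = 0)"
proof
  assume x: "x \<in> integers" and "\<exists>y\<in>integers. x * y = 1"
  then obtain y where y: "y \<in> integers" "x * y = 1" by blast
  then have "x \<noteq> 0" "y \<noteq> 0" by auto
  then have "0 \<le> v x" "0 \<le> v y" "v x + v y = 0" if "v \<in> V" for v
    using that x y val_mult[of v x y] val_1[of v] by (auto simp: integers_def)
  then show "x \<noteq> 0 \<and> (\<forall>v\<in>V. v x = 0)" using \<open>x \<noteq> 0\<close> by fastforce
next
  assume "x \<noteq> 0 \<and> (\<forall>v\<in>V. v x = 0)"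
  then show "\<exists>y\<in>integers. x * y = 1"
    by (intro bexI[of _ "inverse x"]) (auto simp: integers_def val_inverse)
qed

end

text \<open>The ring identities are reflected along the injection d into a field, with
  \<open>neg\<close> supplying additive inverses. Ideals are moved forward to S, where
  \<open>pid\<close> yields a generator.\<close>

lemma principal_domain_transport:
  fixes R :: "'a ring" and d :: "'a \<Rightarrow> 'k::field"
  assumes inj: "inj_on d (carrier R)" and img: "d ` carrier R = S"
    and ops: "\<And>x y. x \<in> carrier R \<Longrightarrow> y \<in> carrier R \<Longrightarrow> d (x \<oplus>\<^bsub>R\<^esub> y) = d x + d y"
      "\<And>x y. x \<in> carrier R \<Longrightarrow> y \<in> carrier R \<Longrightarrow> d (x \<otimes>\<^bsub>R\<^esub> y) = d x * d y"
      "d \<zero>\<^bsub>R\<^esub> = 0" "d \<one>\<^bsub>R\<^esub> = 1"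
    and closed: "\<And>x y. x \<in> carrier R \<Longrightarrow> y \<in> carrier R \<Longrightarrow> x \<oplus>\<^bsub>R\<^esub> y \<in> carrier R"
      "\<And>x y. x \<in> carrier R \<Longrightarrow> y \<in> carrier R \<Longrightarrow> x \<otimes>\<^bsub>R\<^esub> y \<in> carrier R"
      "\<zero>\<^bsub>R\<^esub> \<in> carrier R" "\<one>\<^bsub>R\<^esub> \<in> carrier R"
    and neg: "\<And>x. x \<in> S \<Longrightarrow> - x \<in> S"
    and pid: "\<And>J. J \<subseteq> S \<Longrightarrow> 0 \<in> J \<Longrightarrow> (\<And>x y. x \<in> J \<Longrightarrow> y \<in> J \<Longrightarrow> x + y \<in> J) \<Longrightarrow>
      (\<And>x a. x \<in> J \<Longrightarrow> a \<in> S \<Longrightarrow> a * x \<in> J) \<Longrightarrow> \<exists>c\<in>J. \<forall>x\<in>J. \<exists>a\<in>S. x = a * c"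
  shows "principal_domain R"
proof -
  note eqI = inj_onD[OF inj]
  have cring: "cring R"
  proof (rule cringI)
    show "abelian_group R"
    proof (rule abelian_groupI)
      fix x assume x: "x \<in> carrier R"
      then have "- d x \<in> d ` carrier R" using img neg by blast
      then obtain y where "y \<in> carrier R" "- d x = d y" by blast
      then show "\<exists>y\<in>carrier R. y \<oplus>\<^bsub>R\<^esub> x = \<zero>\<^bsub>R\<^esub>"
        using x by (intro bexI[of _ y] eqI) (auto simp: ops closed dest: sym)
    qed (auto intro!: eqI simp: ops closed algebra_simps)
    show "comm_monoid R"
      by (rule comm_monoidI) (auto intro!: eqI simp: ops closed algebra_simps)
  qed (auto intro!: eqI simp: ops closed algebra_simps)
  interpret cring R by (fact cring)
  interpret domain R
  proof (rule domainI)
    show "\<one>\<^bsub>R\<^esub> \<noteq> \<zero>\<^bsub>R\<^esub>" using ops(3,4) by force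
    fix a b assume ab: "a \<otimes>\<^bsub>R\<^esub> b = \<zero>\<^bsub>R\<^esub>" "a \<in> carrier R" "b \<in> carrier R"
    then have "d a * d b = 0" using ops(2)[of a b] ops(3) by simp
    then show "a = \<zero>\<^bsub>R\<^esub> \<or> b = \<zero>\<^bsub>R\<^esub>" using ab ops(3) eqI closed(3) by (metis mult_eq_0_iff)
  qed (fact cring)
  show ?thesis
  proof (unfold_locales)
    fix I assume I: "ideal I R"
    interpret I: ideal I R by (fact I)
    have sub: "I \<subseteq> carrier R" using I.a_subset by blast
    have "\<exists>c\<in>d ` I. \<forall>x\<in>d ` I. \<exists>a\<in>S. x = a * c"
    proof (rule pid)
      show "d ` I \<subseteq> S" using sub img by blast
      show "0 \<in> d ` I" using ops(3) I.zero_closed by force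
      fix x assume "x \<in> d ` I"
      then obtain x' where x': "x' \<in> I" "x = d x'" by blast
      show "x + y \<in> d ` I" if "y \<in> d ` I" for y
      proof -
        obtain y' where y': "y' \<in> I" "y = d y'" using \<open>y \<in> d ` I\<close> by blast
        have "x + y = d (x' \<oplus>\<^bsub>R\<^esub> y')" using x' y' sub ops(1) by (simp add: subset_iff)
        with I.a_closed[OF x'(1) y'(1)] show ?thesis by blast
      qed
      show "a * x \<in> d ` I" if "a \<in> S" for a
      proof -
        obtain a' where a': "a' \<in> carrier R" "a = d a'" using \<open>a \<in> S\<close> img by blast
        have "a * x = d (a' \<otimes>\<^bsub>R\<^esub> x')" using x' a' sub ops(2) by (simp add: subset_iff)
        with I.I_l_closed[OF x'(1) a'(1)] show ?thesis by blast
      qed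
    qed
    then obtain c where c: "c \<in> I" "\<And>x. x \<in> I \<Longrightarrow> \<exists>a\<in>S. d x = a * d c" by blast
    have "I = PIdl\<^bsub>R\<^esub> c"
    proof
      show "PIdl\<^bsub>R\<^esub> c \<subseteq> I" unfolding cgenideal_def using c(1) I.I_l_closed by blast
      show "I \<subseteq> PIdl\<^bsub>R\<^esub> c"
      proof
        fix x assume x: "x \<in> I"
        obtain a where a: "a \<in> carrier R" "d x = d a * d c" using c(2)[OF x] img by blast
        then have "x = a \<otimes>\<^bsub>R\<^esub> c" using x c(1) sub by (intro eqI) (auto simp: ops)
        with a(1) show "x \<in> PIdl\<^bsub>R\<^esub> c" unfolding cgenideal_def by blast
      qed
    qed
    with c(1) sub show "\<exists>a\<in>carrier R. I = PIdl\<^bsub>R\<^esub> a" by blast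
  qed
qed

section \<open>Monomial valuations on fractions of Dirichlet polynomials\<close>

lemma lookup_mult_keys:
  "Poly_Mapping.lookup (f * g) k = (\<Sum>a\<in>Poly_Mapping.keys f. \<Sum>b\<in>Poly_Mapping.keys g. if a + b = k
      then Poly_Mapping.lookup f a * Poly_Mapping.lookup g b else 0)"
  for f g :: "'a::monoid_add \<Rightarrow>\<^sub>0 'b::semiring_0"
proof -
  have 1: "h = (\<Sum>a\<in>Poly_Mapping.keys h. Poly_Mapping.single a (Poly_Mapping.lookup h a))" for h ::
      "'a \<Rightarrow>\<^sub>0 'b"
    by (rule poly_mapping_eqI) (auto simp: lookup_sum lookup_single when_def in_keys_iff)
  have "f * g = (\<Sum>a\<in>Poly_Mapping.keys f. \<Sum>b\<in>Poly_Mapping.keys g. Poly_Mapping.single (a + b)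
      (Poly_Mapping.lookup f a * Poly_Mapping.lookup g b))"
    by (subst 1[of f], subst 1[of g]) (simp add: sum_product mult_single)
  then show ?thesis by (simp add: lookup_sum lookup_single when_def)
qed

definition minval :: "('a \<Rightarrow> nat) \<Rightarrow> ('a \<Rightarrow>\<^sub>0 'b::zero) \<Rightarrow> nat" where
  "minval w f = Min (w ` Poly_Mapping.keys f)"

lemma minval_le: "a \<in> Poly_Mapping.keys f \<Longrightarrow> minval w f \<le> w a"
  by (simp add: minval_def)

lemma minval_attained:
  assumes "f \<noteq> 0" shows "\<exists>a\<in>Poly_Mapping.keys f. w a = minval w f"
proof -
  have "Min (w ` Poly_Mapping.keys f) \<in> w ` Poly_Mapping.keys f"
    using assms by (intro Min_in) auto
  then show ?thesis unfolding minval_def by force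
qed

lemma minval_ge: "f \<noteq> 0 \<Longrightarrow> (\<And>a. a \<in> Poly_Mapping.keys f \<Longrightarrow> n \<le> w a) \<Longrightarrow> n \<le> minval w f"
  by (metis minval_attained)

lemma minval_add:
  assumes "f \<noteq> 0" "g \<noteq> 0" "f + g \<noteq> 0"
  shows "min (minval w f) (minval w g) \<le> minval w (f + g)"
proof (rule minval_ge[OF assms(3)])
  fix a assume "a \<in> Poly_Mapping.keys (f + g)"
  then have "a \<in> Poly_Mapping.keys f \<or> a \<in> Poly_Mapping.keys g" using keys_add[of f g] by blast
  then show "min (minval w f) (minval w g) \<le> w a"
    using minval_le[of a f w] minval_le[of a g w] unfolding min_le_iff_disj by blast
qed

text \<open>Among the monomials of minimal weight, take the least a of f and the least b of g in the
  order of the monoid. The monomial a + b arises from no other pair, so its coefficient in f * g is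
  a product of two nonzero coefficients and cannot cancel.\<close>

lemma minval_mult:
  fixes f g :: "'a::{ordered_cancel_comm_monoid_add, linorder} \<Rightarrow>\<^sub>0 'b::idom"
  assumes w: "\<And>a b. w (a + b) = w a + w b" and "f \<noteq> 0" "g \<noteq> 0"
  shows "minval w (f * g) = minval w f + minval w g"
proof -
  have "\<exists>a\<in>Poly_Mapping.keys h. w a = minval w h \<and> (\<forall>b\<in>Poly_Mapping.keys h. w b = minval w h \<longrightarrow>
      a \<le> b)"
    if "h \<noteq> 0" for h :: "'a \<Rightarrow>\<^sub>0 'b"
  proof -
    let ?A = "{a \<in> Poly_Mapping.keys h. w a = minval w h}"
    have "Min ?A \<in> ?A" using minval_attained[OF that, of w] by (intro Min_in) auto
    moreover have "Min ?A \<le> b" if "b \<in> ?A" for b using that by (intro Min_le) auto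
    ultimately show ?thesis by blast
  qed
  from this[OF \<open>f \<noteq> 0\<close>] this[OF \<open>g \<noteq> 0\<close>] obtain a b
    where a: "a \<in> Poly_Mapping.keys f" "w a = minval w f" "\<And>x. x \<in> Poly_Mapping.keys f \<Longrightarrow>
        w x = minval w f \<Longrightarrow> a \<le> x"
      and b: "b \<in> Poly_Mapping.keys g" "w b = minval w g" "\<And>x. x \<in> Poly_Mapping.keys g \<Longrightarrow>
          w x = minval w g \<Longrightarrow> b \<le> x"
    by metis
  have uniq: "x + y = a + b \<longleftrightarrow> x = a \<and> y = b" if "x \<in> Poly_Mapping.keys f" "y \<in> Poly_Mapping.keys g"
      for x y
  proof
    assume eq: "x + y = a + b"
    \<comment> \<open>Equal total weight forces both weights to be minimal, hence a <= x and b <= y;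
      strict monotonicity of addition then gives equality.\<close>
    then have "w x + w y = minval w f + minval w g" using w a(2) b(2) by metis
    with minval_le[OF that(1), of w] minval_le[OF that(2), of w]
    have "w x = minval w f" "w y = minval w g" by linarith+
    with a(3) b(3) that have "a \<le> x" "b \<le> y" by auto
    with eq show "x = a \<and> y = b"
      by (metis add_less_le_mono add_le_less_mono order_less_irrefl order_le_less)
  qed simp
  have "Poly_Mapping.lookup (f * g) (a + b) = (\<Sum>x\<in>Poly_Mapping.keys f. \<Sum>y\<in>Poly_Mapping.keys g.
      if y = b then if x = a then Poly_Mapping.lookup f x * Poly_Mapping.lookup g y else 0 else 0)"
    unfolding lookup_mult_keys by (intro sum.cong refl) (auto simp: uniq)
  also have "\<dots> = Poly_Mapping.lookup f a * Poly_Mapping.lookup g b" using a(1) b(1) by simp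
  finally have "Poly_Mapping.lookup (f * g) (a + b) \<noteq> 0" using a(1) b(1) by (simp add: in_keys_iff)
  then have "minval w (f * g) \<le> w (a + b)" by (intro minval_le) (simp add: in_keys_iff)
  moreover have "minval w f + minval w g \<le> minval w (f * g)"
  proof (rule minval_ge)
    show "f * g \<noteq> 0" using assms by simp
    fix k assume "k \<in> Poly_Mapping.keys (f * g)"
    then obtain x y where "k = x + y" "x \<in> Poly_Mapping.keys f" "y \<in> Poly_Mapping.keys g"
      using keys_mult[of f g] by blast
    then show "minval w f + minval w g \<le> w k" using minval_le[of x f w] minval_le[of y g w]
        by (simp add: w)
  qed
  ultimately show ?thesis using a(2) b(2) w by simp
qed

text \<open>The value at 0 is unspecified.\<close>

definition frac_val :: "('a \<Rightarrow> nat) \<Rightarrow> ('a::{ordered_cancel_comm_monoid_add, linorder} \<Rightarrow>\<^sub>0 'b::idom)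
    fract \<Rightarrow> int" where
  "frac_val w x = (THE k. \<exists>f g. f \<noteq> 0 \<and> g \<noteq> 0 \<and> x = Fract f g \<and> k = int (minval w f) - int (minval w
      g))"

section \<open>Well-definedness and valuation laws on the fraction field\<close>

lemma frac_val_Fract:
  fixes f g :: "'a::{ordered_cancel_comm_monoid_add, linorder} \<Rightarrow>\<^sub>0 'b::idom"
  assumes w: "\<And>a b. w (a + b) = w a + w b" and fg: "f \<noteq> 0" "g \<noteq> 0"
  shows "frac_val w (Fract f g) = int (minval w f) - int (minval w g)"
  unfolding frac_val_def
proof (rule the_equality)
  fix k assume "\<exists>f' g'. f' \<noteq> 0 \<and> g' \<noteq> 0 \<and> Fract f g = Fract f' g' \<and> k = int (minval w f') - int
      (minval w g')"
  then obtain f' g' where *: "f' \<noteq> 0" "g' \<noteq> 0" "Fract f g = Fract f' g'"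
    and k: "k = int (minval w f') - int (minval w g')" by blast
  then have "f * g' = f' * g" using fg by (simp add: eq_fract)
  then have "minval w f + minval w g' = minval w f' + minval w g"
    using * fg by (simp flip: minval_mult[OF w])
  then show "k = int (minval w f) - int (minval w g)" using k by simp
qed (use fg in blast)

lemma Fract_nonzero_cases:
  assumes "x \<noteq> (0 :: 'a::idom fract)"
  obtains f g where "x = Fract f g" "f \<noteq> 0" "g \<noteq> 0"
  using assms by (cases x rule: Fract_cases_nonzero) auto

lemma Fract_eq_0_iff: "g \<noteq> 0 \<Longrightarrow> Fract f g = 0 \<longleftrightarrow> f = 0" for f g :: "'a::idom"
  by (simp add: Zero_fract_def eq_fract)

lemma frac_val_mult:
  fixes x y :: "('a::{ordered_cancel_comm_monoid_add, linorder} \<Rightarrow>\<^sub>0 'b::idom) fract"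
  assumes w: "\<And>a b. w (a + b) = w a + w b" and "x \<noteq> 0" "y \<noteq> 0"
  shows "frac_val w (x * y) = frac_val w x + frac_val w y"
  using assms(2,3) by (elim Fract_nonzero_cases) (simp add: frac_val_Fract[OF w] minval_mult[OF w])

lemma frac_val_add:
  fixes x y :: "('a::{ordered_cancel_comm_monoid_add, linorder} \<Rightarrow>\<^sub>0 'b::idom) fract"
  assumes w: "\<And>a b. w (a + b) = w a + w b" and "x \<noteq> 0" "y \<noteq> 0" "x + y \<noteq> 0"
  shows "min (frac_val w x) (frac_val w y) \<le> frac_val w (x + y)"
proof -
  obtain f g where x: "x = Fract f g" "f \<noteq> 0" "g \<noteq> 0" using assms(2) by (rule Fract_nonzero_cases)
  obtain f' g' where y: "y = Fract f' g'" "f' \<noteq> 0" "g' \<noteq> 0" using assms(3)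
      by (rule Fract_nonzero_cases)
  have xy: "x + y = Fract (f * g' + f' * g) (g * g')" using x y by simp
  then have "f * g' + f' * g \<noteq> 0" using assms(4) x(3) y(3) by (auto simp: Fract_eq_0_iff)
  then show ?thesis using minval_add[of "f * g'" "f' * g" w] x y
    by (simp add: xy frac_val_Fract[OF w] minval_mult[OF w])
qed

text \<open>
  \<open>Pmon i\<close> is the monomial encoded by the positive integer \<open>i + 1\<close>, whose prime factors are the
  variables. The monoid of positive integers is written additively; subtraction is only there
  because the type class demands it.
\<close>

datatype pmon = Pmon (idx: nat)

instantiation pmon :: "{ordered_cancel_comm_monoid_add, linorder}"
begin

definition zero_pmon :: pmon where
  "0 = Pmon 0"

definition plus_pmon :: "pmon \<Rightarrow> pmon \<Rightarrow> pmon" where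
  "a + b = Pmon (Suc (idx a) * Suc (idx b) - 1)"

definition minus_pmon :: "pmon \<Rightarrow> pmon \<Rightarrow> pmon" where
  "a - b = Pmon (Suc (idx a) div Suc (idx b) - 1)"

definition less_eq_pmon :: "pmon \<Rightarrow> pmon \<Rightarrow> bool" where
  "a \<le> b \<longleftrightarrow> idx a \<le> idx b"

definition less_pmon :: "pmon \<Rightarrow> pmon \<Rightarrow> bool" where
  "a < b \<longleftrightarrow> idx a < idx b"

instance
proof
  fix a b c :: pmon
  have pmon_eqI: "Suc (idx a) = Suc (idx b) \<Longrightarrow> a = b" for a b :: pmon by (simp add: pmon.expand)
  have val_add: "Suc (idx (a + b)) = Suc (idx a) * Suc (idx b)" for a b :: pmon
    by (simp add: plus_pmon_def)
  have idx_diff: "idx (a - b) = Suc (idx a) div Suc (idx b) - 1" for a b :: pmon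
    by (simp add: minus_pmon_def)
  show "a + b + c = a + (b + c)" "a + b = b + a" by (rule pmon_eqI; simp only: val_add mult_ac)+
  show "0 + a = a" by (simp add: zero_pmon_def plus_pmon_def)
  show "a + b - a = b" by (rule pmon.expand) (simp only: idx_diff val_add, simp del:
      mult_Suc mult_Suc_right)
  show "a - b - c = a - (b + c)"
  proof (rule pmon.expand)
    have "Suc (idx a) div (Suc (idx b) * Suc (idx c)) = Suc (idx a) div Suc (idx b) div Suc (idx c)"
      by (rule div_mult2_eq)
    then show "idx (a - b - c) = idx (a - (b + c))"
      \<comment> \<open>If the first quotient is 0, truncation replaces it by the number 1, and both
        sides still have index 0.\<close>
      by (cases "Suc (idx a) div Suc (idx b) = 0") (simp_all only: idx_diff val_add, auto)
  qed
  show "(a < b) = (a \<le> b \<and> \<not> b \<le> a)" "a \<le> a" "a \<le> b \<Longrightarrow> b \<le> c \<Longrightarrow> a \<le> c"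
    "a \<le> b \<or> b \<le> a" by (auto simp: less_eq_pmon_def less_pmon_def)
  show "a \<le> b \<Longrightarrow> b \<le> a \<Longrightarrow> a = b" by (simp add: less_eq_pmon_def pmon.expand)
  show "a \<le> b \<Longrightarrow> c + a \<le> c + b"
    by (simp add: less_eq_pmon_def plus_pmon_def add_mono)
qed

end

lemma idx_add: "Suc (idx (a + b)) = Suc (idx a) * Suc (idx b)"
  by (simp add: plus_pmon_def)

text \<open>
  The variable \<open>r\<^sub>n\<close> is the prime with index \<open>pair n 0\<close>, and \<open>x\<^sub>n\<^sub>,\<^sub>s\<close> the one with index \<open>pair n s\<close>.
\<close>

definition weight :: "nat \<times> nat \<Rightarrow> pmon \<Rightarrow> nat" where
  "weight = (\<lambda>(n, s) a. multiplicity (odd_prime (pair n 0)) (Suc (idx a))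
     + (if s = 0 then 0 else multiplicity (odd_prime (pair n s)) (Suc (idx a))))"

lemma weight_add: "weight i (a + b) = weight i a + weight i b"
  using prime_odd_prime
      by (cases i) (simp add: weight_def idx_add prime_elem_multiplicity_mult_distrib del:
          mult_Suc mult_Suc_right)

type_synonym 'b frac = "(pmon \<Rightarrow>\<^sub>0 'b) fract"

section \<open>Which variables can occur in a given monomial\<close>

lemma weight_pos_le:
  assumes "0 < weight (n, s) a"
  shows "n \<le> idx a"
proof -
  have le: "j \<le> idx a" if "0 < multiplicity (odd_prime j) (Suc (idx a))" for j
  proof -
    have "odd_prime j dvd Suc (idx a)" using that by (metis not_dvd_imp_multiplicity_0 less_irrefl)
    then have "odd_prime j \<le> Suc (idx a)" by (rule dvd_imp_le) simp
    with odd_prime_gt[of j] show ?thesis by simp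
  qed
  have "0 < multiplicity (odd_prime (pair n 0)) (Suc (idx a)) \<or>
      0 < multiplicity (odd_prime (pair n s)) (Suc (idx a))"
    using assms by (auto simp: weight_def split: if_splits)
  then have "pair n 0 \<le> idx a \<or> pair n s \<le> idx a" using le by blast
  with pair_ge(1) show ?thesis using order_trans by blast
qed

lemma weight_0_le: "weight (n, 0) a \<le> weight (n, s) a"
  by (simp add: weight_def)

text \<open>The prime of x_{n,s} exceeds s, so it divides no positive number up to s. Together with
  \<open>weight_0_le\<close> this makes the condition at (n, s) a consequence of the one at (n, 0)
  once s exceeds all monomial indices of the denominator.\<close>

lemma weight_large: "idx a < s \<Longrightarrow> weight (n, s) a = weight (n, 0) a"
proof -
  assume "idx a < s"
  then have "Suc (idx a) < odd_prime (pair n s)" using odd_prime_gt[of "pair n s"] pair_ge(2)[of s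
      n] by linarith
  then have "\<not> odd_prime (pair n s) dvd Suc (idx a)" by (auto dest: dvd_imp_le)
  then show ?thesis by (simp add: weight_def not_dvd_imp_multiplicity_0)
qed

lemma minval_weight_large:
  assumes "f \<noteq> 0" "\<And>a. a \<in> Poly_Mapping.keys f \<Longrightarrow> idx a < s"
  shows "minval (weight (n, s)) f = minval (weight (n, 0)) f"
  unfolding minval_def using assms(2) weight_large
      by (auto intro!: arg_cong[where f=Min] image_cong)

lemma minval_weight_0_le: "f \<noteq> 0 \<Longrightarrow> minval (weight (n, 0)) f \<le> minval (weight (n, s)) f"
proof (erule minval_ge)
  fix a assume "a \<in> Poly_Mapping.keys f"
  then have "minval (weight (n, 0)) f \<le> weight (n, 0) a" by (rule minval_le)
  then show "minval (weight (n, 0)) f \<le> weight (n, s) a" using weight_0_le order_trans by blast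
qed

definition last_event :: "(nat \<Rightarrow> nat \<Rightarrow> bool) \<Rightarrow> nat \<Rightarrow> nat \<Rightarrow> bool" where
  "last_event P n s \<longleftrightarrow> 0 < s \<and> P n s \<and> (\<forall>s'>s. \<not> P n s')"

text \<open>The second component 0 stands for the r_n-adic valuation and a positive s for the
  condition imposed by the event s, which is why \<open>last_event\<close> asks for
  \<open>0 < s\<close>.\<close>

definition active :: "(nat \<Rightarrow> nat \<Rightarrow> bool) \<Rightarrow> (nat \<times> nat) set" where
  "active P = {(n, s). s = 0 \<or> last_event P n s}"

lemma finite_active_fibre: "finite {s. (n, s) \<in> active P}"
proof -
  have "s = s'" if "last_event P n s" "last_event P n s'" for s s'
    using that unfolding last_event_def by (metis linorder_neqE_nat)
  then have "{s. (n, s) \<in> active P} \<subseteq> {0, THE s. last_event P n s}"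
    unfolding active_def by (auto simp: the_equality)
  then show ?thesis by (rule finite_subset) simp
qed

text \<open>One monomial of f is enough: a weight whose minimum on f is positive is positive on it,
  so n is at most its index, and each n has at most two active pairs.\<close>

lemma finite_weight_support: "finite {i \<in> active P. minval (weight i) f \<noteq> 0}" if "f \<noteq> 0"
proof -
  obtain a where a: "a \<in> Poly_Mapping.keys f" using \<open>f \<noteq> 0\<close> by (metis keys_eq_empty ex_in_conv)
  have "{i \<in> active P. minval (weight i) f \<noteq> 0} \<subseteq> Sigma {..idx a} (\<lambda>n. {s. (n, s) \<in> active P})"
  proof
    fix i assume i: "i \<in> {i \<in> active P. minval (weight i) f \<noteq> 0}"
    obtain n s where ns: "i = (n, s)" by (cases i)
    have "0 < weight (n, s) a" using i minval_le[OF a, of "weight (n, s)"] by (simp add: ns)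
    then have "n \<le> idx a" by (rule weight_pos_le)
    with i show "i \<in> Sigma {..idx a} (\<lambda>n. {s. (n, s) \<in> active P})" by (simp add: ns)
  qed
  then show ?thesis by (rule finite_subset) (simp add: finite_active_fibre)
qed

section \<open>Variables and the mixing property\<close>

definition var_mon :: "nat \<Rightarrow> pmon \<Rightarrow>\<^sub>0 'b::zero_neq_one" where
  "var_mon q = Poly_Mapping.single (Pmon (q - 1)) 1"

lemma var_mon_nonzero [simp]: "var_mon q \<noteq> 0"
  unfolding var_mon_def by (metis lookup_single_eq lookup_zero zero_neq_one)

lemma minval_var_mon: "minval w (var_mon q :: pmon \<Rightarrow>\<^sub>0 'b::zero_neq_one) = w (Pmon (q - 1))"
  by (simp add: var_mon_def minval_def)

lemma minval_weight_var_mon: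
  assumes "0 < q"
  shows "minval (weight (n, s)) (var_mon q :: pmon \<Rightarrow>\<^sub>0 'b::zero_neq_one) =
    multiplicity (odd_prime (pair n 0)) q + (if s = 0 then 0 else multiplicity (odd_prime (pair n
        s)) q)"
  using assms by (simp add: minval_var_mon weight_def)

lemma multiplicity_odd_prime_2_power: "multiplicity (odd_prime k) (2 ^ m) = 0"
proof -
  have "\<not> odd_prime k dvd 2 ^ m"
    using odd_prime_gt[of k] prime_dvd_power[OF prime_odd_prime[of k], of 2 m] dvd_imp_le[of
        "odd_prime k" 2] by auto
  then show ?thesis by (rule not_dvd_imp_multiplicity_0)
qed

text \<open>Disjoint supports exclude cancellation, so the minimum over the union is the smaller of
  the two minima. Powers of 2 have weight 0 throughout, so a single m serves all the
  weights.\<close>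

lemma minval_mix:
  fixes f g :: "pmon \<Rightarrow>\<^sub>0 'b::idom"
  assumes "f \<noteq> 0" "g \<noteq> 0"
  obtains m where "f + var_mon (2 ^ m) * g \<noteq> 0"
    "\<And>i. minval (weight i) (f + var_mon (2 ^ m) * g) = min (minval (weight i) f) (minval (weight i)
        g)"
proof -
  \<comment> \<open>The bound on the indices in f also serves as the exponent of u, because m < 2 ^
    m.\<close>
  obtain m where m: "\<And>a. a \<in> Poly_Mapping.keys f \<Longrightarrow> idx a < m"
    using finite_nat_set_iff_bounded[of "idx ` Poly_Mapping.keys f"] by auto
  let ?t = "var_mon (2 ^ m) :: pmon \<Rightarrow>\<^sub>0 'b"
  have keys_t: "Poly_Mapping.keys ?t = {Pmon (2 ^ m - 1)}" by (simp add: var_mon_def)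
  have big: "m \<le> idx a" if a: "a \<in> Poly_Mapping.keys (?t * g)" for a
  proof -
    obtain b where "a = Pmon (2 ^ m - 1) + b" using a keys_mult[of ?t g] keys_t by auto
    then have "Suc (idx a) = 2 ^ m * Suc (idx b)" by (simp add: idx_add)
    moreover have "m < 2 ^ m" by (rule less_exp)
    ultimately have "2 ^ m \<le> Suc (idx a)" "m < 2 ^ m" by simp_all
    then show ?thesis by linarith
  qed
  have disj: "Poly_Mapping.keys f \<inter> Poly_Mapping.keys (?t * g) = {}" using m big
      by (force simp: not_less)
  have keys: "Poly_Mapping.keys (f + ?t * g) = Poly_Mapping.keys f \<union> Poly_Mapping.keys (?t * g)"
  proof (rule Set.set_eqI)
    fix a
    have "Poly_Mapping.lookup f a = 0 \<or> Poly_Mapping.lookup (?t * g) a = 0" using disj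
        by (auto simp: in_keys_iff)
    then show "a \<in> Poly_Mapping.keys (f + ?t * g) \<longleftrightarrow> a \<in> Poly_Mapping.keys f \<union> Poly_Mapping.keys
        (?t * g)"
      by (auto simp: in_keys_iff lookup_add)
  qed
  have tg: "?t * g \<noteq> 0" using assms(2) by simp
  have "minval (weight i) (f + ?t * g) = min (minval (weight i) f) (minval (weight i) (?t * g))"
      for i
    unfolding minval_def keys image_Un using assms(1) tg by (intro Min_Un) auto
  moreover have "minval (weight i) (?t * g) = minval (weight i) g" for i
    using minval_mult[of "weight i" ?t g, OF weight_add _ assms(2)]
    by (cases i) (simp add: minval_weight_var_mon multiplicity_odd_prime_2_power)
  moreover have "f + ?t * g \<noteq> 0" using keys assms(1) by (metis Un_empty keys_eq_empty)
  ultimately show ?thesis by (intro that) auto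
qed

lemma valued_field_weights:
  "valued_field ((\<lambda>i. frac_val (weight i)) ` active P :: ('b::idom frac \<Rightarrow> int) set)"
proof
  fix v :: "'b frac \<Rightarrow> int" and x y :: "'b frac"
  assume "v \<in> (\<lambda>i. frac_val (weight i)) ` active P" and xy: "x \<noteq> 0" "y \<noteq> 0"
  then obtain i where v: "v = frac_val (weight i)" by blast
  show "v (x * y) = v x + v y" unfolding v using weight_add xy by (rule frac_val_mult)
  show "x + y \<noteq> 0 \<Longrightarrow> min (v x) (v y) \<le> v (x + y)" unfolding v using weight_add xy
      by (rule frac_val_add)
next
  fix x :: "'b frac" assume "x \<noteq> 0"
  then obtain f g where x: "x = Fract f g" "f \<noteq> 0" "g \<noteq> 0" by (rule Fract_nonzero_cases)
  have "{v \<in> (\<lambda>i. frac_val (weight i)) ` active P. v x \<noteq> 0} \<subseteq> (\<lambda>i. frac_val (weight i)) `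
      ({i \<in> active P. minval (weight i) f \<noteq> 0} \<union> {i \<in> active P. minval (weight i) g \<noteq> 0})"
    using x by (auto simp: frac_val_Fract[OF weight_add])
  then show "finite {v \<in> (\<lambda>i. frac_val (weight i)) ` active P. v x \<noteq> 0}"
    by (rule finite_subset) (intro finite_imageI finite_UnI finite_weight_support x)
next
  fix x y :: "'b frac" assume xy: "x \<noteq> 0" "y \<noteq> 0"
  obtain f h where x: "x = Fract f h" "f \<noteq> 0" "h \<noteq> 0" using xy(1) by (rule Fract_nonzero_cases)
  obtain g k where y: "y = Fract g k" "g \<noteq> 0" "k \<noteq> 0" using xy(2) by (rule Fract_nonzero_cases)
  \<comment> \<open>Over the common denominator h k, mixing x = f / h with y = g / k amounts to
    mixing the numerators f k and g h.\<close>
  obtain m where m: "f * k + var_mon (2 ^ m) * (g * h) \<noteq> 0"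
    "\<And>i. minval (weight i) (f * k + var_mon (2 ^ m) * (g * h)) = min (minval (weight i) (f * k))
        (minval (weight i) (g * h))"
    using minval_mix[of "f * k" "g * h"] x y by auto
  define w :: "'b frac" where "w = Fract (var_mon (2 ^ m)) 1"
  have xwy: "x + w * y = Fract (f * k + var_mon (2 ^ m) * (g * h)) (h * k)"
    using x y by (simp add: w_def mult_ac)
  have "minval (weight i) (1 :: pmon \<Rightarrow>\<^sub>0 'b) = 0" for i
    using minval_mult[of "weight i" 1 "1 :: pmon \<Rightarrow>\<^sub>0 'b", OF weight_add] by simp
  then have "frac_val (weight i) w = 0" for i
    by (cases i) (simp add: w_def frac_val_Fract[OF weight_add] minval_weight_var_mon
        multiplicity_odd_prime_2_power)
  moreover have "frac_val (weight i) (x + w * y) = min (frac_val (weight i) x) (frac_val (weight i)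
      y)" for i
  proof -
    have "frac_val (weight i) (x + w * y) = int (minval (weight i) (f * k + var_mon (2 ^ m) *
        (g * h))) - int (minval (weight i) (h * k))"
      unfolding xwy using m(1) x(3) y(3) by (intro frac_val_Fract weight_add) auto
    moreover have "frac_val (weight i) x = int (minval (weight i) f) - int (minval (weight i) h)"
      unfolding x(1) using x by (intro frac_val_Fract weight_add)
    moreover have "frac_val (weight i) y = int (minval (weight i) g) - int (minval (weight i) k)"
      unfolding y(1) using y by (intro frac_val_Fract weight_add)
    ultimately show ?thesis
      unfolding m(2) using x(2,3) y(2,3) by (simp add: minval_mult[OF weight_add])
  qed
  moreover have "w \<noteq> 0" by (simp add: w_def Fract_eq_0_iff)
  moreover have "x + w * y \<noteq> 0"
    unfolding xwy using m(1) x(3) y(3) by (subst Fract_eq_0_iff) auto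
  ultimately show "\<exists>w. w \<noteq> 0 \<and> x + w * y \<noteq> 0 \<and>
      (\<forall>v\<in>(\<lambda>i. frac_val (weight i)) ` active P. v w = 0 \<and> v (x + w * y) = min (v x) (v y))"
    by blast
qed

section \<open>The ring and its irreducible elements\<close>

text \<open>The index k packs a program with an argument, so that one ring serves all Pi02 sets at
  once.\<close>

definition settled :: "nat \<Rightarrow> nat \<Rightarrow> nat \<Rightarrow> bool" where
  "settled k l w \<longleftrightarrow> (\<forall>x<l. \<exists>d\<le>w. universal (pair_fst k) (pair_snd k) x d)"

text \<open>
  Apart from the initial one, an event has the form \<open>pair l w + 2\<close> with \<open>w\<close> least such that
  \<open>settled k l w\<close>; so every \<open>l\<close> contributes at most one event, and exactly one iff the first
  \<open>l\<close> instances of the \<open>\<Pi>\<^sup>0\<^sub>2\<close> condition are all satisfied.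
\<close>

definition event :: "nat \<Rightarrow> nat \<Rightarrow> bool" where
  "event k s \<longleftrightarrow> s = 1 \<or> (2 \<le> s \<and> settled k (pair_fst (s - 2)) (pair_snd (s - 2))
     \<and> (\<forall>w<pair_snd (s - 2). \<not> settled k (pair_fst (s - 2)) w))"

lemma recursive_settled: "recursive l a \<Longrightarrow> recursive l b \<Longrightarrow> recursive l c \<Longrightarrow>
    decidable l (\<lambda>e. settled (a e) (b e) (c e))"
  by (rule recursive_comp3[where F="\<lambda>a b c. of_bool (settled a b c)"], unfold settled_def,
      intro recursive_intros recursive_universal recursive_pair_fst recursive_pair_snd)

lemma recursive_event: "recursive l a \<Longrightarrow> recursive l b \<Longrightarrow> decidable l (\<lambda>e. event (a e) (b e))"
  by (rule recursive_comp2[where F="\<lambda>a b. of_bool (event a b)"], unfold event_def,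
      intro recursive_intros recursive_settled recursive_pair_fst recursive_pair_snd)

lemma event_pair: "event k (pair l w + 2) \<longleftrightarrow> settled k l w \<and> (\<forall>w'<w. \<not> settled k l w')"
  by (simp add: event_def)

lemma ex_settled: "(\<And>x. x < l \<Longrightarrow> \<exists>d. universal (pair_fst k) (pair_snd k) x d) \<Longrightarrow> \<exists>w. settled k l w"
proof -
  assume "\<And>x. x < l \<Longrightarrow> \<exists>d. universal (pair_fst k) (pair_snd k) x d"
  then obtain d where d: "\<And>x. x < l \<Longrightarrow> universal (pair_fst k) (pair_snd k) x (d x)" by metis
  have "settled k l (\<Sum>x<l. d x)"
    unfolding settled_def using d by (auto intro!: exI[of _ "d _"] member_le_sum)
  then show ?thesis ..
qed

text \<open>If all instances have witnesses, every l contributes an event, and these are unbounded.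
  If instance x fails, only l <= x contribute, so there are finitely many events; since 1 is one of
  them, a largest exists.\<close>

lemma no_last_event_iff:
  "(\<nexists>s. last_event event k s) \<longleftrightarrow> (\<forall>x. \<exists>d. universal (pair_fst k) (pair_snd k) x d)"
proof
  assume all: "\<forall>x. \<exists>d. universal (pair_fst k) (pair_snd k) x d"
  show "\<nexists>s. last_event event k s"
  proof
    assume "\<exists>s. last_event event k s"
    then obtain s where s: "\<And>s'. s < s' \<Longrightarrow> \<not> event k s'" unfolding last_event_def by blast
    \<comment> \<open>The event contributed by l = s comes after s, because a pair is at least its
      first component.\<close>
    have "\<exists>w. settled k s w" using all by (intro ex_settled) blast
    then have "settled k s (LEAST w. settled k s w)" by (rule LeastI_ex)
    moreover have "\<not> settled k s w" if "w < (LEAST w. settled k s w)" for w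
      using that by (rule not_less_Least)
    ultimately have "event k (pair s (LEAST w. settled k s w) + 2)" unfolding event_pair by blast
    moreover have "s < pair s (LEAST w. settled k s w) + 2"
      using pair_ge(1)[of s "LEAST w. settled k s w"] by linarith
    ultimately show False using s by blast
  qed
next
  assume no_last: "\<nexists>s. last_event event k s"
  show "\<forall>x. \<exists>d. universal (pair_fst k) (pair_snd k) x d"
  proof (rule ccontr)
    assume "\<not> (\<forall>x. \<exists>d. universal (pair_fst k) (pair_snd k) x d)"
    then obtain x where x: "\<And>d. \<not> universal (pair_fst k) (pair_snd k) x d" by blast
    have "Collect (event k) \<subseteq> {1} \<union> (\<lambda>l. pair l (LEAST w. settled k l w) + 2) ` {..x}"
    proof
      fix s assume "s \<in> Collect (event k)"
      then consider "s = 1" | "2 \<le> s" "event k s" by (auto simp: event_def)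
      then show "s \<in> {1} \<union> (\<lambda>l. pair l (LEAST w. settled k l w) + 2) ` {..x}"
      proof cases
        case 2
        define l w where "l = pair_fst (s - 2)" and "w = pair_snd (s - 2)"
        have s: "s = pair l w + 2" using 2(1) by (simp add: l_def w_def)
        then have lw: "settled k l w" "\<And>w'. w' < w \<Longrightarrow> \<not> settled k l w'"
          using 2(2) unfolding s event_pair by blast+
        have "w = (LEAST w. settled k l w)"
          using lw by (intro Least_equality[symmetric]) (auto simp: not_less[symmetric])
        moreover have "l \<le> x" using lw(1) x unfolding settled_def by (meson not_less)
        ultimately show ?thesis using s by auto
      qed simp
    qed
    then have fin: "finite (Collect (event k))" by (rule finite_subset) simp
    have "event k 1" by (simp add: event_def)
    then have "event k (Max (Collect (event k)))" "1 \<le> Max (Collect (event k))"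
      using fin Max_in[OF fin] by (auto intro: Max_ge)
    moreover have "\<not> event k s" if "Max (Collect (event k)) < s" for s
      using fin that by (metis Max_ge mem_Collect_eq not_less)
    ultimately have "last_event event k (Max (Collect (event k)))" by (auto simp: last_event_def)
    with no_last show False by blast
  qed
qed

section \<open>The ring inside the fraction field and the values of its variables\<close>

definition event_vals :: "(bit frac \<Rightarrow> int) set" where
  "event_vals = (\<lambda>i. frac_val (weight i)) ` active event"

interpretation VF: valued_field event_vals
  unfolding event_vals_def by (rule valued_field_weights)

abbreviation frac_ring :: "bit frac set" where "frac_ring \<equiv> VF.integers"

definition r_elt :: "nat \<Rightarrow> bit frac" where "r_elt n = Fract (var_mon (odd_prime (pair n 0))) 1"
definition x_elt :: "nat \<Rightarrow> nat \<Rightarrow> bit frac" where "x_elt n s = Fract (var_mon (odd_prime (pair n s)))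
    1"

lemma multiplicity_odd_prime: "multiplicity (odd_prime j) (odd_prime k) = of_bool (j = k)"
  using prime_odd_prime[of j] prime_odd_prime[of k] by (auto simp: prime_multiplicity_other)

lemma minval_1: "minval (weight i) (1 :: pmon \<Rightarrow>\<^sub>0 bit) = 0"
  using minval_mult[of "weight i" 1 "1 :: pmon \<Rightarrow>\<^sub>0 bit", OF weight_add] by simp

lemma frac_val_var_mon:
  "frac_val (weight (m, t)) (Fract (var_mon (odd_prime (pair n s)) :: pmon \<Rightarrow>\<^sub>0 bit) 1) =
    of_bool (m = n \<and> s = 0) + of_bool (t \<noteq> 0 \<and> m = n \<and> t = s)"
proof -
  have "0 < odd_prime k" for k using odd_prime_gt[of k] by simp
  then show ?thesis
    by (auto simp: frac_val_Fract[OF weight_add] minval_weight_var_mon multiplicity_odd_prime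
        minval_1)
qed

lemma event_vals_r: "frac_val (weight (m, t)) (r_elt n :: bit frac) = of_bool (m = n)"
  unfolding r_elt_def by (auto simp: frac_val_var_mon)

lemma event_vals_x: "0 < s \<Longrightarrow> frac_val (weight (m, t)) (x_elt n s :: bit frac) = of_bool (m = n \<and>
    t = s)"
  unfolding x_elt_def by (auto simp: frac_val_var_mon)

lemma r_x_elt_nonzero: "r_elt n \<noteq> (0 :: bit frac)" "x_elt n s \<noteq> (0 :: bit frac)"
  by (simp_all add: r_elt_def x_elt_def Fract_eq_0_iff)

lemma ball_event_vals: "(\<forall>v\<in>event_vals. Q v) \<longleftrightarrow> (\<forall>n s. (n, s) \<in> active event \<longrightarrow>
    Q (frac_val (weight (n, s))))"
  unfolding event_vals_def by auto

lemma frac_ring_iff: "x \<in> (frac_ring :: bit frac set) \<longleftrightarrow> x = 0 \<or> (\<forall>n s. (n, s) \<in> active event \<longrightarrow>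
    0 \<le> frac_val (weight (n, s)) x)"
  by (simp add: VF.integers_def ball_event_vals)

definition irreducible_frac :: "bit frac \<Rightarrow> bool" where
  "irreducible_frac x \<longleftrightarrow> x \<noteq> 0 \<and> (\<forall>y\<in>frac_ring. x * y \<noteq> 1) \<and>
    (\<forall>a\<in>frac_ring. \<forall>b\<in>frac_ring. x = a * b \<longrightarrow> (\<exists>y\<in>frac_ring. a * y = 1) \<or> (\<exists>y\<in>frac_ring. b * y = 1))"

lemma r_elt_integer: "r_elt n \<in> (frac_ring :: bit frac set)"
  by (simp add: frac_ring_iff event_vals_r)

lemma frac_ring_unit_iff:
  "x \<in> frac_ring \<Longrightarrow> (\<exists>y\<in>frac_ring. x * y = (1 :: bit frac)) \<longleftrightarrow>
    x \<noteq> 0 \<and> (\<forall>n s. (n, s) \<in> active event \<longrightarrow> frac_val (weight (n, s)) x = 0)"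
  by (simp add: VF.integers_unit_iff ball_event_vals)

lemma active_0: "(n, 0) \<in> active P"
  by (simp add: active_def)

lemma irreducible_frac_r_elt_iff: "irreducible_frac (r_elt n :: bit frac) \<longleftrightarrow>
    (\<nexists>s. last_event event n s)"
proof
  assume irreducible_frac: "irreducible_frac (r_elt n :: bit frac)"
  show "\<nexists>s. last_event event n s"
  proof
    assume "\<exists>s. last_event event n s"
    then obtain s where s: "last_event event n s" by blast
    then have s0: "0 < s" and act: "(n, s) \<in> active event"
        by (simp_all add: last_event_def active_def)
    define y where "y = r_elt n * inverse (x_elt n s :: bit frac)"
    have y: "r_elt n = x_elt n s * y" "y \<noteq> 0" by (simp_all add: y_def r_x_elt_nonzero)
    \<comment> \<open>At (n, 0) the value of y is 1, so y is no unit. At the active pair (n, s) it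
      is 0, as the value 1 of r_n there is taken up by \<open>x_elt n s\<close>.\<close>
    have vy: "frac_val (weight (m, t)) y = of_bool (m = n \<and> t \<noteq> s)" for m t
    proof -
      have "frac_val (weight (m, t)) (r_elt n :: bit frac) = frac_val (weight (m, t)) (x_elt n s) +
          frac_val (weight (m, t)) y"
        unfolding y(1) by (intro frac_val_mult weight_add r_x_elt_nonzero y(2))
      then show ?thesis using s0 by (auto simp: event_vals_r event_vals_x)
    qed
    have "x_elt n s \<in> (frac_ring :: bit frac set)" "y \<in> frac_ring" using s0
        by (simp_all add: frac_ring_iff event_vals_x vy)
    moreover have "\<not> (\<exists>z\<in>frac_ring. x_elt n s * z = (1 :: bit frac))"
      using act s0 calculation(1) by (subst frac_ring_unit_iff) (auto simp: event_vals_x)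
    moreover have "\<not> (\<exists>z\<in>frac_ring. y * z = 1)"
      using active_0[of n event] s0 calculation(2) by (subst frac_ring_unit_iff) (auto simp:
          vy intro!: exI[of _ 0])
    ultimately show False using irreducible_frac y(1) unfolding irreducible_frac_def by blast
  qed
next
  assume no_last: "\<nexists>s. last_event event n s"
  \<comment> \<open>Only the r_n-adic valuation remains active over n. There the values of two
    factors are nonnegative integers with sum 1, so one of them is 0; at the active pairs of other
    indices both values vanish.\<close>
  have act: "t = 0" if "(n, t) \<in> active event" for t using that no_last by (auto simp: active_def)
  show "irreducible_frac (r_elt n :: bit frac)"
    unfolding irreducible_frac_def
  proof (intro conjI ballI impI)
    show "r_elt n \<noteq> (0 :: bit frac)" by (rule r_x_elt_nonzero)
    have "\<not> (\<exists>y\<in>frac_ring. r_elt n * y = (1 :: bit frac))"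
      using active_0[of n event] r_elt_integer by (subst frac_ring_unit_iff) (auto simp:
          event_vals_r intro!: exI[of _ 0])
    then show "r_elt n * y \<noteq> (1 :: bit frac)" if "y \<in> frac_ring" for y using that by blast
    fix a b :: "bit frac" assume ab: "a \<in> frac_ring" "b \<in> frac_ring" "r_elt n = a * b"
    then have nz: "a \<noteq> 0" "b \<noteq> 0" using r_x_elt_nonzero(1)[of n] by auto
    have sum: "frac_val (weight (m, t)) a + frac_val (weight (m, t)) b = of_bool (m = n)" for m t
      using frac_val_mult[of "weight (m, t)", OF weight_add nz] event_vals_r[of m t n] ab(3) by simp
    have ge: "0 \<le> frac_val (weight (m, t)) a" "0 \<le> frac_val (weight (m, t)) b"
        if "(m, t) \<in> active event" for m t
      using ab(1,2) nz that by (auto simp: frac_ring_iff)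
    have "frac_val (weight (m, t)) a = 0 \<and> frac_val (weight (m, t)) b = 0"
        if "(m, t) \<in> active event" "m \<noteq> n" for m t
      using sum[of m t] ge[OF that(1)] that(2) by simp
    moreover have "frac_val (weight (n, 0)) a = 0 \<or> frac_val (weight (n, 0)) b = 0"
      using sum[of n 0] ge[OF active_0, of n] by auto
    ultimately have "(\<forall>m t. (m, t) \<in> active event \<longrightarrow> frac_val (weight (m, t)) a = 0) \<or>
        (\<forall>m t. (m, t) \<in> active event \<longrightarrow> frac_val (weight (m, t)) b = 0)" using act by metis
    then show "(\<exists>y\<in>frac_ring. a * y = 1) \<or> (\<exists>y\<in>frac_ring. b * y = 1)"
      unfolding frac_ring_unit_iff[OF ab(1)] frac_ring_unit_iff[OF ab(2)] using nz by blast
  qed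
qed

section \<open>Computable presentation and completeness\<close>

text \<open>The two-element field pays off here: binary digits match the finite sets of monomials
  with the natural numbers one to one, so equality of polynomials is equality of codes.\<close>

definition dpoly :: "nat \<Rightarrow> pmon \<Rightarrow>\<^sub>0 bit" where
  "dpoly c = (\<Sum>i\<in>set_decode c. Poly_Mapping.single (Pmon i) 1)"

lemma lookup_dpoly: "Poly_Mapping.lookup (dpoly c) a = of_bool (idx a \<in> set_decode c)"
proof -
  have "Poly_Mapping.lookup (dpoly c) a = (\<Sum>i\<in>set_decode c. if idx a = i then 1 else 0)"
    unfolding dpoly_def lookup_sum lookup_single when_def by (intro sum.cong) (auto simp:
        pmon.expand)
  then show ?thesis by simp
qed

lemma keys_dpoly: "Poly_Mapping.keys (dpoly c) = Pmon ` set_decode c"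
proof -
  have "a \<in> Poly_Mapping.keys (dpoly c) \<longleftrightarrow> idx a \<in> set_decode c" for a
    by (simp add: in_keys_iff lookup_dpoly)
  then show ?thesis by (force intro: pmon.expand)
qed

lemma dpoly_eqI: "(\<And>i. Poly_Mapping.lookup f (Pmon i) = of_bool (i \<in> set_decode c)) \<Longrightarrow> dpoly c = f"
  by (rule poly_mapping_eqI) (metis lookup_dpoly pmon.collapse)

lemma dpoly_eq_iff [simp]: "dpoly c = dpoly d \<longleftrightarrow> c = d"
proof
  assume "dpoly c = dpoly d"
  then have "(of_bool (i \<in> set_decode c) :: bit) = of_bool (i \<in> set_decode d)" for i
    using lookup_dpoly[of c "Pmon i"] lookup_dpoly[of d "Pmon i"] by simp
  then have "set_decode c = set_decode d" by (simp add: of_bool_eq_iff set_eq_iff)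
  then show "c = d" by (metis set_decode_inverse)
qed simp

lemma dpoly_0: "dpoly 0 = 0"
  by (simp add: dpoly_def)

lemma dpoly_eq_0_iff [simp]: "dpoly c = 0 \<longleftrightarrow> c = 0"
  using dpoly_eq_iff[of c 0] by (simp add: dpoly_0)

lemma dpoly_power: "dpoly (2 ^ i) = Poly_Mapping.single (Pmon i) 1"
proof -
  have "set_decode (2 ^ i) = {i}" using set_encode_inverse[of "{i}"] by (simp add: set_encode_def)
  then show ?thesis by (simp add: dpoly_def)
qed

lemma dpoly_1: "dpoly 1 = 1"
  using dpoly_power[of 0] by (simp add: zero_pmon_def[symmetric])

lemma surj_dpoly: "\<exists>c. f = dpoly c"
proof -
  have "finite (idx ` Poly_Mapping.keys f)" by simp
  then have "set_decode (set_encode (idx ` Poly_Mapping.keys f)) = idx ` Poly_Mapping.keys f"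
    by (rule set_encode_inverse)
  moreover have "Poly_Mapping.lookup f (Pmon i) = of_bool (i \<in> idx ` Poly_Mapping.keys f)" for i
  proof (cases "Poly_Mapping.lookup f (Pmon i) = 0")
    case False
    then have "Pmon i \<in> Poly_Mapping.keys f" by (simp add: in_keys_iff)
    then have "i \<in> idx ` Poly_Mapping.keys f" by force
    with False show ?thesis by (simp only: bit_not_zero_iff of_bool_eq if_True)
  qed (auto simp: in_keys_iff)
  ultimately have "f = dpoly (set_encode (idx ` Poly_Mapping.keys f))"
      by (intro dpoly_eqI[symmetric]) simp
  then show ?thesis ..
qed

lemma set_decode_less: "i \<in> set_decode c \<Longrightarrow> i < c"
proof -
  assume "i \<in> set_decode c"
  then have "odd (c div 2 ^ i)" by (simp add: set_decode_def)
  then have "c div 2 ^ i \<noteq> 0" by (metis dvd_0_right)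
  then have "2 ^ i \<le> c" by (simp add: div_eq_0_iff)
  with less_exp[of i] show ?thesis by linarith
qed

section \<open>Addition and multiplication of polynomial codes\<close>

definition dpoly_code_add :: "nat \<Rightarrow> nat \<Rightarrow> nat" where
  "dpoly_code_add c d = set_encode {i. i < c + d \<and> (i \<in> set_decode c \<longleftrightarrow> i \<notin> set_decode d)}"

text \<open>Dirichlet convolution modulo 2: the coefficient is the parity of the number of
  admissible factorisations of k + 1. The bound loses nothing, since i < c and j < d give k + 1 <= c
  d.\<close>

definition dpoly_code_mult :: "nat \<Rightarrow> nat \<Rightarrow> nat" where
  "dpoly_code_mult c d = set_encode {k. k < c * d \<and>
     (\<Sum>i<c. \<Sum>j<d. of_bool (i \<in> set_decode c \<and> j \<in> set_decode d \<and> Suc i * Suc j = Suc k)) mod 2 =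
         (1::nat)}"

lemma dpoly_code_add_correct: "dpoly (dpoly_code_add c d) = dpoly c + dpoly d"
proof (rule dpoly_eqI)
  fix i
  have eq: "set_decode (dpoly_code_add c d) = {i. i < c + d \<and> (i \<in> set_decode c \<longleftrightarrow>
      i \<notin> set_decode d)}"
    unfolding dpoly_code_add_def by (rule set_encode_inverse) simp
  have "i < c + d" if "i \<in> set_decode c \<or> i \<in> set_decode d"
    using that set_decode_less[of i c] set_decode_less[of i d] by linarith
  then have "i \<in> set_decode (dpoly_code_add c d) \<longleftrightarrow> (i \<in> set_decode c \<longleftrightarrow> i \<notin> set_decode d)"
    unfolding eq by blast
  then show "Poly_Mapping.lookup (dpoly c + dpoly d) (Pmon i) = of_bool (i \<in> set_decode
      (dpoly_code_add c d))"
    by (cases "i \<in> set_decode c"; cases "i \<in> set_decode d") (simp_all add: lookup_add lookup_dpoly)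
qed

lemma of_nat_bit: "(of_nat n :: bit) = of_bool (n mod 2 = 1)"
proof (induction n)
  case (Suc n)
  have "Suc n mod 2 = 1 \<longleftrightarrow> n mod 2 \<noteq> 1" by presburger
  with Suc show ?case by (cases "n mod 2 = 1") simp_all
qed simp

lemma dpoly_code_mult_correct: "dpoly (dpoly_code_mult c d) = dpoly c * dpoly d"
proof (rule dpoly_eqI)
  fix k
  let ?n = "\<Sum>i<c. \<Sum>j<d. of_bool (i \<in> set_decode c \<and> j \<in> set_decode d \<and> Suc i * Suc j = Suc k) ::
      nat"
  have Pmon_add: "Pmon i + Pmon j = Pmon k \<longleftrightarrow> Suc i * Suc j = Suc k" for i j
    by (auto simp: plus_pmon_def)
  have "Poly_Mapping.lookup (dpoly c * dpoly d) (Pmon k) =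
      (\<Sum>i\<in>set_decode c. \<Sum>j\<in>set_decode d. if Pmon i + Pmon j = Pmon k then 1 else 0)"
    unfolding lookup_mult_keys keys_dpoly
    by (simp add: sum.reindex inj_on_def lookup_dpoly cong: if_cong)
  also have "\<dots> = (\<Sum>i\<in>set_decode c. \<Sum>j\<in>set_decode d. of_bool (Suc i * Suc j = Suc k))"
    unfolding Pmon_add of_bool_def ..
  also have "\<dots> = (\<Sum>i\<in>set_decode c. \<Sum>j<d. of_bool (j \<in> set_decode d \<and> Suc i * Suc j = Suc k))"
    by (intro sum.cong refl sum.mono_neutral_cong_left) (auto dest: set_decode_less)
  also have "\<dots> = (\<Sum>i<c. \<Sum>j<d. of_bool (i \<in> set_decode c \<and> j \<in> set_decode d \<and>
      Suc i * Suc j = Suc k))"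
    by (intro sum.mono_neutral_cong_left) (auto dest: set_decode_less)
  also have "\<dots> = of_nat ?n" by (simp del: mult_Suc mult_Suc_right)
  finally have lookup: "Poly_Mapping.lookup (dpoly c * dpoly d) (Pmon k) = of_bool (?n mod 2 = 1)"
    by (simp only: of_nat_bit)
  have "k < c * d" if "?n mod 2 = 1"
  proof -
    have "?n \<noteq> 0" using that by (metis mod_0 zero_neq_one)
    then have "\<exists>i<c. \<exists>j<d. Suc i * Suc j = Suc k"
      by (rule contrapos_np) (simp del: mult_Suc mult_Suc_right)
    then obtain i j where ij: "i < c" "j < d" "Suc i * Suc j = Suc k" by blast
    then have "Suc i * Suc j \<le> c * d" by (intro mult_le_mono) simp_all
    with ij(3) show ?thesis by simp
  qed
  moreover have "set_decode (dpoly_code_mult c d) = {k. k < c * d \<and>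
     (\<Sum>i<c. \<Sum>j<d. of_bool (i \<in> set_decode c \<and> j \<in> set_decode d \<and> Suc i * Suc j = Suc k)) mod 2 =
         (1::nat)}"
    unfolding dpoly_code_mult_def by (rule set_encode_inverse) simp
  ultimately have "k \<in> set_decode (dpoly_code_mult c d) \<longleftrightarrow> ?n mod 2 = 1" by auto
  then show "Poly_Mapping.lookup (dpoly c * dpoly d) (Pmon k) = of_bool (k \<in> set_decode
      (dpoly_code_mult c d))"
    using lookup by simp
qed

text \<open>Two minima are compared without computing them: each monomial of f must be matched by
  one of g of no larger weight. The bounds on i and j are harmless, as digit positions are smaller
  than the number, and make the relation decidable.\<close>

definition le_minval :: "nat \<Rightarrow> nat \<Rightarrow> nat \<Rightarrow> nat \<Rightarrow> bool" where
  "le_minval n s g f \<longleftrightarrow> (\<forall>i<f. i \<in> set_decode f \<longrightarrow>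
     (\<exists>j<g. j \<in> set_decode g \<and> weight (n, s) (Pmon j) \<le> weight (n, s) (Pmon i)))"

lemma le_minval_iff:
  assumes "f \<noteq> 0" "g \<noteq> 0"
  shows "le_minval n s g f \<longleftrightarrow> minval (weight (n, s)) (dpoly g) \<le> minval (weight (n, s)) (dpoly f)"
proof
  assume le: "le_minval n s g f"
  show "minval (weight (n, s)) (dpoly g) \<le> minval (weight (n, s)) (dpoly f)"
  proof (rule minval_ge)
    show "dpoly f \<noteq> 0" using assms by simp
    fix a assume "a \<in> Poly_Mapping.keys (dpoly f)"
    then obtain i where i: "a = Pmon i" "i \<in> set_decode f" by (auto simp: keys_dpoly)
    then obtain j where j: "j \<in> set_decode g" "weight (n, s) (Pmon j) \<le> weight (n, s) a"
      using le set_decode_less[of i f] unfolding le_minval_def by blast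
    then have "minval (weight (n, s)) (dpoly g) \<le> weight (n, s) (Pmon j)"
      by (intro minval_le) (simp add: keys_dpoly)
    with j(2) show "minval (weight (n, s)) (dpoly g) \<le> weight (n, s) a" by simp
  qed
next
  assume le: "minval (weight (n, s)) (dpoly g) \<le> minval (weight (n, s)) (dpoly f)"
  obtain j where j: "j \<in> set_decode g" "weight (n, s) (Pmon j) = minval (weight (n, s)) (dpoly g)"
    using minval_attained[of "dpoly g" "weight (n, s)"] assms(2) by (auto simp: keys_dpoly)
  have "weight (n, s) (Pmon j) \<le> weight (n, s) (Pmon i)" if "i \<in> set_decode f" for i
    using le j(2) minval_le[of "Pmon i" "dpoly f" "weight (n, s)"] that by (simp add: keys_dpoly)
  with j(1) show "le_minval n s g f" unfolding le_minval_def using set_decode_less by blast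
qed

text \<open>
  The number \<open>w\<close> bounds the later events that excuse violated conditions. Checking \<open>n\<close> and \<open>s\<close> up
  to the code \<open>g\<close> of the denominator suffices, since the remaining variables do not occur in it.
\<close>

definition valid :: "nat \<Rightarrow> nat \<Rightarrow> nat \<Rightarrow> bool" where
  "valid f g w \<longleftrightarrow> g \<noteq> 0 \<and> (f = 0 \<or> (\<forall>n\<le>g. \<forall>s\<le>g. le_minval n s g f \<or>
     (s \<noteq> 0 \<and> (event n s \<longrightarrow> (\<exists>s'\<le>w. s < s' \<and> event n s')))))"

lemma valid_imp_integer:
  assumes "valid f g w" shows "Fract (dpoly f) (dpoly g) \<in> frac_ring"
proof (cases "f = 0")
  case True
  with assms show ?thesis by (simp add: dpoly_0 valid_def frac_ring_iff Fract_eq_0_iff)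
next
  case False
  have g: "g \<noteq> 0" using assms by (simp add: valid_def)
  have keys: "idx a < g" if "a \<in> Poly_Mapping.keys (dpoly g)" for a
    using that by (auto simp: keys_dpoly set_decode_less)
  have le: "minval (weight (n, s)) (dpoly g) \<le> minval (weight (n, s)) (dpoly f)"
    if "(n, s) \<in> active event" "n \<le> g" "s \<le> g" for n s
  proof -
    \<comment> \<open>An active condition admits no excuse: either s = 0, or s is an event with no
      later one.\<close>
    have "le_minval n s g f"
      using assms that False unfolding valid_def active_def last_event_def by blast
    with le_minval_iff[OF False g] show ?thesis by simp
  qed
  have "minval (weight (n, s)) (dpoly g) \<le> minval (weight (n, s)) (dpoly f)"
    if act: "(n, s) \<in> active event" for n s
  proof -
    consider "g < n" | "n \<le> g" "s \<le> g" | "n \<le> g" "g < s" by linarith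
    then show ?thesis
    proof cases
      case 1
      \<comment> \<open>For n > g any monomial of the denominator has weight 0, so the minimum is 0
        and the condition is automatic.\<close>
      obtain a where a: "a \<in> Poly_Mapping.keys (dpoly g)" using minval_attained[of "dpoly g"
          "\<lambda>_. 0"] g by auto
      then have "weight (n, s) a = 0" using keys[OF a] weight_pos_le[of n s a] 1 by linarith
      then show ?thesis using minval_le[OF a, of "weight (n, s)"] by simp
    next
      case 2
      with le act show ?thesis by blast
    next
      case 3
      \<comment> \<open>Passing from (n, 0) to (n, s) leaves the value of the denominator unchanged
        and can only increase that of the numerator.\<close>
      have "minval (weight (n, s)) (dpoly g) = minval (weight (n, 0)) (dpoly g)"
        using g keys 3(2) by (intro minval_weight_large) (auto intro: less_trans)
      also have "\<dots> \<le> minval (weight (n, 0)) (dpoly f)" using le active_0 3(1) by simp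
      also have "\<dots> \<le> minval (weight (n, s)) (dpoly f)" using False
          by (intro minval_weight_0_le) simp
      finally show ?thesis .
    qed
  qed
  then show ?thesis using False g by (auto simp: frac_ring_iff frac_val_Fract[OF weight_add])
qed

text \<open>Only finitely many pairs are tested, and each one that has to be excused is excused by a
  single later event. The filter \<open>sequentially\<close> combines these into a common bound
  w.\<close>

lemma integer_imp_valid:
  assumes "Fract (dpoly f) (dpoly g) \<in> frac_ring" "g \<noteq> 0"
  shows "\<exists>w. valid f g w"
proof (cases "f = 0")
  case True
  with assms(2) show ?thesis by (simp add: valid_def)
next
  case False
  then have "Fract (dpoly f) (dpoly g) \<noteq> 0" using assms(2) by (simp add: Fract_eq_0_iff)
  then have le: "le_minval n s g f" if "(n, s) \<in> active event" for n s
    using assms that False by (auto simp: frac_ring_iff frac_val_Fract[OF weight_add] le_minval_iff)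
  have "\<forall>\<^sub>F w in sequentially. event n s \<longrightarrow> le_minval n s g f \<or> (s \<noteq> 0 \<and> (\<exists>s'\<le>w. s < s' \<and>
      event n s'))" for n s
  proof (cases "event n s \<and> (n, s) \<notin> active event")
    case True
    then obtain s' where "s \<noteq> 0" "s < s'" "event n s'" by (auto simp: active_def last_event_def)
    then show ?thesis using eventually_ge_at_top[of s']
        by (intro eventually_mono[OF eventually_ge_at_top[of s']]) blast
  qed (use le in auto)
  then have "\<forall>\<^sub>F w in sequentially. \<forall>n\<in>{..g}. \<forall>s\<in>{..g}.
      event n s \<longrightarrow> le_minval n s g f \<or> (s \<noteq> 0 \<and> (\<exists>s'\<le>w. s < s' \<and> event n s'))"
    by (intro eventually_ball_finite ballI) auto
  then obtain w where w: "\<forall>n\<in>{..g}. \<forall>s\<in>{..g}.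
      event n s \<longrightarrow> le_minval n s g f \<or> (s \<noteq> 0 \<and> (\<exists>s'\<le>w. s < s' \<and> event n s'))"
    unfolding eventually_sequentially by blast
  have "le_minval n 0 g f" for n using le active_0 .
  then have "valid f g w" using w assms(2) unfolding valid_def by (metis atMost_iff)
  then show ?thesis ..
qed

text \<open>A code consists of numerator, denominator and excuse bound; storing the bound makes an
  enumerable condition decidable. Invalid numbers are read as 0 / 1, which keeps
  \<open>decode\<close> total and \<open>num\<close> and \<open>denom\<close> computable.\<close>

definition valid_code :: "nat \<Rightarrow> bool"
    where "valid_code z = valid (pair_fst z) (pair_fst (pair_snd z)) (pair_snd (pair_snd z))"
definition num :: "nat \<Rightarrow> nat" where "num z = (if valid_code z then pair_fst z else 0)"
definition denom :: "nat \<Rightarrow> nat" where "denom z = (if valid_code z then pair_fst (pair_snd z) else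
    1)"
definition decode :: "nat \<Rightarrow> bit frac" where "decode z = Fract (dpoly (num z)) (dpoly (denom z))"

lemma denom_nonzero [simp]: "denom z \<noteq> 0"
  by (simp add: denom_def valid_code_def valid_def)

lemma decode_integer: "decode z \<in> frac_ring"
proof (cases "valid_code z")
  case True
  then show ?thesis unfolding valid_code_def
      by (simp add: decode_def num_def denom_def valid_code_def valid_imp_integer)
next
  case False
  then show ?thesis by (simp add: decode_def num_def denom_def dpoly_0 frac_ring_iff Fract_eq_0_iff)
qed

lemma decode_valid: "valid f g w \<Longrightarrow> decode (pair f (pair g w)) = Fract (dpoly f) (dpoly g)"
  by (simp add: decode_def num_def denom_def valid_code_def)

lemma decode_surj:
  assumes "x \<in> frac_ring" shows "\<exists>z. decode z = x"
proof -
  obtain F G where x: "x = Fract F G" "G \<noteq> 0" by (cases x) auto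
  obtain f g where "F = dpoly f" "G = dpoly g" using surj_dpoly by metis
  then have x': "x = Fract (dpoly f) (dpoly g)" "g \<noteq> 0" using x by auto
  with assms integer_imp_valid obtain w where "valid f g w" by blast
  then show ?thesis using x' decode_valid by metis
qed

section \<open>Decidability of equality, sums and products by cross multiplication\<close>

lemma decode_eq_iff: "decode x = decode y \<longleftrightarrow> dpoly_code_mult (num x) (denom y) = dpoly_code_mult
    (num y) (denom x)"
  unfolding dpoly_eq_iff[symmetric] dpoly_code_mult_correct decode_def by (simp add: eq_fract del:
      dpoly_eq_iff)

lemma decode_add_iff: "decode x + decode y = decode z \<longleftrightarrow>
    dpoly_code_mult (dpoly_code_add (dpoly_code_mult (num x) (denom y)) (dpoly_code_mult (num y)
        (denom x))) (denom z) = dpoly_code_mult (num z) (dpoly_code_mult (denom x) (denom y))"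
  unfolding dpoly_eq_iff[symmetric] dpoly_code_mult_correct dpoly_code_add_correct decode_def
      by (simp add: eq_fract del: dpoly_eq_iff)

lemma decode_mult_iff: "decode x * decode y = decode z \<longleftrightarrow>
    dpoly_code_mult (dpoly_code_mult (num x) (num y)) (denom z) = dpoly_code_mult (num z)
        (dpoly_code_mult (denom x) (denom y))"
  unfolding dpoly_eq_iff[symmetric] dpoly_code_mult_correct decode_def by (simp add: eq_fract del:
      dpoly_eq_iff)

lemma recursive_dpoly_code_add: "recursive l a \<Longrightarrow> recursive l b \<Longrightarrow>
    recursive l (\<lambda>e. dpoly_code_add (a e) (b e))"
  by (rule recursive_comp2[where F=dpoly_code_add], unfold dpoly_code_add_def,
      intro recursive_set_encode recursive_intros recursive_iff recursive_mem)

lemma recursive_dpoly_code_mult: "recursive l a \<Longrightarrow> recursive l b \<Longrightarrow>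
    recursive l (\<lambda>e. dpoly_code_mult (a e) (b e))"
  by (rule recursive_comp2[where F=dpoly_code_mult], unfold dpoly_code_mult_def,
      intro recursive_set_encode recursive_intros recursive_mem recursive_mod)

lemma recursive_weight: "recursive l a \<Longrightarrow> recursive l b \<Longrightarrow> recursive l c \<Longrightarrow>
    recursive l (\<lambda>e. weight (a e, b e) (Pmon (c e)))"
  by (rule recursive_comp3[where F="\<lambda>a b c. weight (a, b) (Pmon c)"], unfold weight_def prod.case
      pmon.sel,
      intro recursive_intros recursive_multiplicity recursive_pair)

lemma recursive_le_minval: "recursive l a \<Longrightarrow> recursive l b \<Longrightarrow> recursive l c \<Longrightarrow> recursive l d \<Longrightarrow>
    decidable l (\<lambda>e. le_minval (a e) (b e) (c e) (d e))"
  by (rule recursive_comp4[where F="\<lambda>a b c d. of_bool (le_minval a b c d)"], unfold le_minval_def,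
      intro recursive_intros recursive_weight recursive_mem)

lemma recursive_valid_code: "recursive l a \<Longrightarrow> decidable l (\<lambda>e. valid_code (a e))"
  by (rule recursive_comp1[where F="\<lambda>a. of_bool (valid_code a)"], unfold valid_code_def valid_def,
      intro recursive_intros recursive_le_minval recursive_event recursive_pair_fst
          recursive_pair_snd)

lemma recursive_num: "recursive l a \<Longrightarrow> recursive l (\<lambda>e. num (a e))"
  by (rule recursive_comp1[where F=num], unfold num_def, intro recursive_intros recursive_valid_code
      recursive_pair_fst)

lemma recursive_denom: "recursive l a \<Longrightarrow> recursive l (\<lambda>e. denom (a e))"
  by (rule recursive_comp1[where F=denom], unfold denom_def, intro recursive_intros
      recursive_valid_code recursive_pair_fst recursive_pair_snd)

lemma recursive_decode_eq: "recursive l a \<Longrightarrow> recursive l b \<Longrightarrow> decidable l (\<lambda>e. decode (a e) = decode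
    (b e))"
  unfolding decode_eq_iff by (intro recursive_eq recursive_dpoly_code_mult recursive_num
      recursive_denom)

lemma recursive_decode_add: "recursive l a \<Longrightarrow> recursive l b \<Longrightarrow> recursive l c \<Longrightarrow>
    decidable l (\<lambda>e. decode (a e) + decode (b e) = decode (c e))"
  unfolding decode_add_iff by (intro recursive_eq recursive_dpoly_code_mult recursive_dpoly_code_add
      recursive_num recursive_denom)

lemma recursive_decode_mult: "recursive l a \<Longrightarrow> recursive l b \<Longrightarrow> recursive l c \<Longrightarrow>
    decidable l (\<lambda>e. decode (a e) * decode (b e) = decode (c e))"
  unfolding decode_mult_iff by (intro recursive_eq recursive_dpoly_code_mult recursive_num
      recursive_denom)

section \<open>The ring of least codes\<close>

definition least_code :: "bit frac \<Rightarrow> nat" where "least_code x = (LEAST z. decode z = x)"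

text \<open>An element has many codes, differing in the fraction and in the excuse bound. The least
  code takes the place of a normal form, and decidable equality of decoded values makes it
  recognisable. Sums and products are found by searching for a code of the result.\<close>

definition code_ring :: "nat ring" where
  "code_ring = \<lparr>carrier = {z. \<forall>y<z. decode y \<noteq> decode z}, mult = (\<lambda>x y. least_code (decode x *
      decode y)), one = least_code 1,
     zero = least_code 0, add = (\<lambda>x y. least_code (decode x + decode y))\<rparr>"

lemma code_ring_simps:
  "carrier code_ring = {z. \<forall>y<z. decode y \<noteq> decode z}"
  "x \<otimes>\<^bsub>code_ring\<^esub> y = least_code (decode x * decode y)" "\<one>\<^bsub>code_ring\<^esub> = least_code 1"
      "\<zero>\<^bsub>code_ring\<^esub> = least_code 0" "x \<oplus>\<^bsub>code_ring\<^esub> y = least_code (decode x + decode y)"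
  by (simp_all add: code_ring_def)

lemma decode_least_code: "x \<in> frac_ring \<Longrightarrow> decode (least_code x) = x"
  unfolding least_code_def using decode_surj by (rule LeastI_ex)

lemma least_code_carrier: "x \<in> frac_ring \<Longrightarrow> least_code x \<in> carrier code_ring"
proof -
  assume x: "x \<in> frac_ring"
  have "decode y \<noteq> decode (least_code x)" if "y < least_code x" for y
    unfolding decode_least_code[OF x] using that unfolding least_code_def by (rule not_less_Least)
  then show ?thesis by (simp add: code_ring_simps(1))
qed

lemma inj_on_decode: "inj_on decode (carrier code_ring)"
proof (rule inj_onI)
  fix x y assume "x \<in> carrier code_ring" "y \<in> carrier code_ring" "decode x = decode y"
  then have "\<not> x < y" "\<not> y < x" unfolding code_ring_simps(1) mem_Collect_eq by metis+
  then show "x = y" by simp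
qed

lemma decode_image: "decode ` carrier code_ring = frac_ring"
proof
  show "decode ` carrier code_ring \<subseteq> frac_ring" using decode_integer by blast
  show "frac_ring \<subseteq> decode ` carrier code_ring"
  proof
    fix x assume "x \<in> frac_ring"
    then have "x = decode (least_code x)" "least_code x \<in> carrier code_ring"
        by (simp_all only: decode_least_code least_code_carrier)
    then show "x \<in> decode ` carrier code_ring" by (rule image_eqI)
  qed
qed

lemma principal_domain_code_ring: "principal_domain code_ring"
proof (rule principal_domain_transport)
  show "inj_on decode (carrier code_ring)" by (rule inj_on_decode)
  show "decode ` carrier code_ring = frac_ring" by (rule decode_image)
  show "\<exists>c\<in>J. \<forall>x\<in>J. \<exists>a\<in>frac_ring. x = a * c" if "J \<subseteq> frac_ring" "0 \<in> J" "\<And>x y. x \<in> J \<Longrightarrow> y \<in> J \<Longrightarrow>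
      x + y \<in> J"
    "\<And>x a. x \<in> J \<Longrightarrow> a \<in> frac_ring \<Longrightarrow> a * x \<in> J" for J
    using that by (rule VF.integers_principal)
qed (simp_all add: code_ring_simps(2-5) decode_least_code least_code_carrier decode_integer
    VF.integers_closed)

lemma computable_ring_code_ring: "computable_ring code_ring"
proof -
  interpret principal_domain code_ring by (rule principal_domain_code_ring)
  have "computable_set (carrier code_ring)"
    unfolding computable_set_iff code_ring_simps mem_Collect_eq
        by (intro recursive_intros recursive_decode_eq)
  moreover have "computable_op_on (carrier code_ring) (\<lambda>x y. x \<oplus>\<^bsub>code_ring\<^esub> y)"
  proof (rule computable_op_onI)
    \<comment> \<open>Closure under addition makes the unbounded search for a code
      terminate.\<close>
    have "\<exists>z. decode x + decode y = decode z" for x y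
      using decode_surj[OF VF.integers_closed(3)[OF decode_integer decode_integer]] by metis
    then show "recursive (\<lambda>p::nat\<times>nat\<times>unit. [fst p, fst (snd p)]) (\<lambda>p. fst p \<oplus>\<^bsub>code_ring\<^esub> fst
        (snd p))"
      unfolding code_ring_simps least_code_def eq_commute[of "decode _" "_ + _"]
          by (intro recursive_intros recursive_decode_add)
  qed
  moreover have "computable_op_on (carrier code_ring) (\<lambda>x y. x \<otimes>\<^bsub>code_ring\<^esub> y)"
  proof (rule computable_op_onI)
    have "\<exists>z. decode x * decode y = decode z" for x y
      using decode_surj[OF VF.integers_closed(4)[OF decode_integer decode_integer]] by metis
    then show "recursive (\<lambda>p::nat\<times>nat\<times>unit. [fst p, fst (snd p)]) (\<lambda>p. fst p \<otimes>\<^bsub>code_ring\<^esub> fst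
        (snd p))"
      unfolding code_ring_simps least_code_def eq_commute[of "decode _" "_ * _"]
          by (intro recursive_intros recursive_decode_mult)
  qed
  ultimately show ?thesis unfolding computable_ring_def using is_cring by blast
qed

section \<open>Irreducibility in the coded ring and its completeness\<close>

lemma code_ring_mult_eq_iff: "a \<in> carrier code_ring \<Longrightarrow> b \<in> carrier code_ring \<Longrightarrow>
    c \<in> carrier code_ring \<Longrightarrow>
    a \<otimes>\<^bsub>code_ring\<^esub> b = c \<longleftrightarrow> decode a * decode b = decode c"
  using inj_onD[OF inj_on_decode, of "a \<otimes>\<^bsub>code_ring\<^esub> b" c]
  by (auto simp: code_ring_simps(2) decode_least_code least_code_carrier decode_integer
      VF.integers_closed)

lemma ring_irreducible_code_ring_iff:
  assumes z: "z \<in> carrier code_ring"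
  shows "ring_irreducible\<^bsub>code_ring\<^esub> z \<longleftrightarrow> irreducible_frac (decode z)"
proof -
  interpret principal_domain code_ring by (rule principal_domain_code_ring)
  have zero: "z = \<zero>\<^bsub>code_ring\<^esub> \<longleftrightarrow> decode z = 0"
    using inj_onD[OF inj_on_decode _ z zero_closed]
        by (auto simp: code_ring_simps(4) decode_least_code VF.integers_closed)
  have one: "decode \<one>\<^bsub>code_ring\<^esub> = 1" by (simp add: code_ring_simps(3) decode_least_code
      VF.integers_closed)
  have unit: "a \<in> Units code_ring \<longleftrightarrow> (\<exists>y\<in>frac_ring. decode a * y = 1)" if "a \<in> carrier code_ring"
      for a
  proof -
    have "a \<in> Units code_ring \<longleftrightarrow> (\<exists>b\<in>carrier code_ring. a \<otimes>\<^bsub>code_ring\<^esub> b = \<one>\<^bsub>code_ring\<^esub>)"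
      using that m_comm unfolding Units_def by auto
    also have "\<dots> \<longleftrightarrow> (\<exists>b\<in>carrier code_ring. decode a * decode b = 1)"
      using that one code_ring_mult_eq_iff[OF that _ one_closed] by auto
    also have "\<dots> \<longleftrightarrow> (\<exists>y\<in>frac_ring. decode a * y = 1)" unfolding decode_image[symmetric] by simp
    finally show ?thesis .
  qed
  have "(\<forall>a\<in>carrier code_ring. \<forall>b\<in>carrier code_ring. z = a \<otimes>\<^bsub>code_ring\<^esub> b \<longrightarrow> a \<in> Units code_ring \<or>
      b \<in> Units code_ring) \<longleftrightarrow>
      (\<forall>a\<in>carrier code_ring. \<forall>b\<in>carrier code_ring. decode z = decode a * decode b \<longrightarrow>
        (\<exists>y\<in>frac_ring. decode a * y = 1) \<or> (\<exists>y\<in>frac_ring. decode b * y = 1))"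
    using code_ring_mult_eq_iff[OF _ _ z] unit by (metis (no_types, lifting))
  also have "\<dots> \<longleftrightarrow> (\<forall>a\<in>frac_ring. \<forall>b\<in>frac_ring. decode z = a * b \<longrightarrow> (\<exists>y\<in>frac_ring. a * y = 1) \<or>
      (\<exists>y\<in>frac_ring. b * y = 1))"
    unfolding decode_image[symmetric] by simp
  finally show ?thesis unfolding ring_irreducible_iff[OF z] irreducible_frac_def zero
      using unit[OF z] by blast
qed

lemma decode_const: "decode 0 = 0" "decode (pair 1 (pair 1 0)) = 1"
proof -
  \<comment> \<open>The number 0 unpacks to denominator 0, so it is invalid and is read as the
    element 0.\<close>
  have "\<not> valid_code 0" using pair_fst_le[of "pair_snd 0"] pair_snd_le[of 0]
      by (simp add: valid_code_def valid_def)
  then show "decode 0 = 0" by (simp add: decode_def num_def denom_def dpoly_0 Fract_eq_0_iff)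
  have "valid 1 1 0" unfolding valid_def le_minval_def by auto
  then show "decode (pair 1 (pair 1 0)) = 1" using decode_valid[of 1 1 0] dpoly_1
      by (simp add: One_fract_def)
qed

text \<open>Being a non-unit is universal over codes and being a unit existential, which gives
  forall-exists. In \<open>Q\<close>, x packs two candidate factors, the first doubling as a
  candidate inverse of n, and y is a candidate inverse of either factor. Explicit codes stand for 0
  and 1.\<close>

lemma Pi02_irreducibles: "Pi02 {z \<in> carrier code_ring. ring_irreducible\<^bsub>code_ring\<^esub> z}"
proof -
  define Q where "Q n x y \<longleftrightarrow> (\<forall>m<n. decode m \<noteq> decode n) \<and> decode n \<noteq> decode 0 \<and>
      decode n * decode (pair_fst x) \<noteq> decode (pair 1 (pair 1 0)) \<and>
     (decode (pair_fst x) * decode (pair_snd x) = decode n \<longrightarrow>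
       decode (pair_fst x) * decode y = decode (pair 1 (pair 1 0)) \<or> decode (pair_snd x) * decode y
           = decode (pair 1 (pair 1 0)))" for n x y
  have "computable_rel3 Q"
    unfolding computable_rel3_iff Q_def by (intro recursive_intros recursive_decode_eq
        recursive_decode_mult recursive_pair_fst recursive_pair_snd)
  moreover have "(z \<in> carrier code_ring \<and> ring_irreducible\<^bsub>code_ring\<^esub> z) \<longleftrightarrow> (\<forall>x. \<exists>y. Q z x y)" for z
  proof -
    have frac_ring: "(\<exists>y\<in>frac_ring. P y) \<longleftrightarrow> (\<exists>y. P (decode y))" "(\<forall>y\<in>frac_ring. P y) \<longleftrightarrow>
        (\<forall>y. P (decode y))" for P
      using decode_surj decode_integer by metis+
    have "(\<forall>x. \<exists>y. Q z x y) \<longleftrightarrow> z \<in> carrier code_ring \<and> (\<forall>a b. decode z \<noteq> 0 \<and>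
        decode z * decode a \<noteq> 1 \<and>
       (decode a * decode b = decode z \<longrightarrow> (\<exists>y. decode a * decode y = 1) \<or> (\<exists>y. decode b * decode y =
           1)))"
      (is "?L \<longleftrightarrow> ?R")
    proof
      assume L: ?L
      show ?R
      proof (intro conjI allI)
        show "z \<in> carrier code_ring" using L unfolding Q_def code_ring_simps by blast
        fix a b
        obtain y where "Q z (pair a b) y" using L by blast
        then show "decode z \<noteq> 0" "decode z * decode a \<noteq> 1"
          "decode a * decode b = decode z \<longrightarrow> (\<exists>y. decode a * decode y = 1) \<or>
              (\<exists>y. decode b * decode y = 1)"
          unfolding Q_def decode_const pair_simps by blast+
      qed
    next
      assume R: ?R
      show ?L unfolding Q_def decode_const using R unfolding code_ring_simps by blast
    qed
    also have "\<dots> \<longleftrightarrow> z \<in> carrier code_ring \<and> irreducible_frac (decode z)"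
      unfolding irreducible_frac_def frac_ring by (metis (no_types))
    finally show ?thesis using ring_irreducible_code_ring_iff by blast
  qed
  ultimately show ?thesis unfolding Pi02_def by blast
qed

text \<open>Denominator 1 violates no condition, so the excuse bound 0 works for every n whatever
  its events are. Hence a code of r_n is computable from n.\<close>

lemma decode_r_elt: "decode (pair (2 ^ (odd_prime (pair n 0) - 1)) (pair 1 0)) = r_elt n"
proof -
  have "valid (2 ^ (odd_prime (pair n 0) - 1)) 1 0"
    unfolding valid_def le_minval_def by (auto simp: weight_def)
  then show ?thesis using decode_valid dpoly_1 by (simp add: r_elt_def dpoly_power var_mon_def)
qed

lemma many_one_reducible_irreducibles:
  assumes "Pi02 B"
  shows "many_one_reducible B {z \<in> carrier code_ring. ring_irreducible\<^bsub>code_ring\<^esub> z}"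
proof -
  obtain P where P: "computable_rel3 P" "B = {n. \<forall>x. \<exists>y. P n x y}"
    using assms unfolding Pi02_def by blast
  obtain c where c: "\<And>n x. (\<exists>y. P n x y) \<longleftrightarrow> (\<exists>d. universal c n x d)"
    using universal_complete[OF P(1)] by blast
  \<comment> \<open>The program c for B is fixed and only the argument n varies. The explicit code
    may fail to be the least one, so g searches for the latter.\<close>
  define name_of where "name_of n = pair (2 ^ (odd_prime (pair (pair c n) 0) - 1)) (pair 1 0)" for n
  define g where "g n = (LEAST z. decode z = decode (name_of n))" for n
  have "computable_fun g"
    unfolding computable_fun_iff g_def name_of_def by (intro recursive_intros recursive_decode_eq
        recursive_pair recursive_odd_prime) blast
  moreover have "n \<in> B \<longleftrightarrow> g n \<in> {z \<in> carrier code_ring. ring_irreducible\<^bsub>code_ring\<^esub> z}" for n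
  proof -
    have g: "g n = least_code (r_elt (pair c n))" by (simp only: g_def name_of_def least_code_def
        decode_r_elt)
    have "n \<in> B \<longleftrightarrow> (\<forall>x. \<exists>d. universal c n x d)" by (simp add: P(2) c)
    also have "\<dots> \<longleftrightarrow> irreducible_frac (r_elt (pair c n))"
      unfolding irreducible_frac_r_elt_iff no_last_event_iff pair_simps ..
    finally show ?thesis
      using r_elt_integer least_code_carrier decode_least_code
          by (simp add: g ring_irreducible_code_ring_iff)
  qed
  ultimately show ?thesis unfolding many_one_reducible_def by blast
qed

theorem theorem6p39:
  shows "\<exists>R :: nat ring. computable_ring R \<and> principal_domain R
           \<and> Pi02_complete {r \<in> carrier R. ring_irreducible\<^bsub>R\<^esub> r}"
  unfolding Pi02_complete_def
  using computable_ring_code_ring principal_domain_code_ring Pi02_irreducibles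
      many_one_reducible_irreducibles by blast

end
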